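(* Let $\omega$ be a non-principal ultrafilter over $\mathbb N$. There exist a sequence $(n_k)_{k\in\mathbb N}$ of positive integers and a sofic representation $\theta\colon\mathbb F_2\hookrightarrow\Pi_{k\to\omega}S_{n_k}$ of the free group $\mathbb F_2$ of rank $2$ such that its commutant $$\theta(\mathbb F_2)'=\{p\in\Pi_{k\to\omega}S_{n_k}:\ p\,\theta(w)=\theta(w)\,p\ \ \forall w\in\mathbb F_2\}$$ is trivial, i.e. contains only the identity element $1_\omega$.
   Context: $S_n$ is the symmetric group on $\{1,\ldots,n\}$ with identity $1_n$, and $d_H(p,q)=\frac1n\mathrm{Card}\{i:p(i)\neq q(i)\}$ is the normalized Hamming distance. The universal sofic group is $$\Pi_{k\to\omega}S_{n_k}=\Pi_{k\in\mathbb N}S_{n_k}\big/\{(p_k)_k:\lim_{k\to\omega}d_H(p_k,1_{n_k})=0\},$$ with identity $1_\omega$ and bi-invariant metric $d_\omega$ given on classes by $d_\omega((p_k)_k,(q_k)_k)=\lim_{k\to\omega}d_H(p_k,q_k)$. A sofic representation of a group $G$ is a homomorphism $\theta\colon G\to\Pi_{k\to\omega}S_{n_k}$ with $d_\omega(\theta(g),1_\omega)=1$ for every $1_G\neq g\in G$. *)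

theory Defs
  imports "HOL-Analysis.Analysis" "HOL-Algebra.Sym_Groups" "HOL-Algebra.Product_Groups"
begin

section \<open>Ultrafilters\<close>

definition is_ultrafilter :: "'a filter \<Rightarrow> bool" where
  "is_ultrafilter F \<longleftrightarrow> F \<noteq> bot \<and> (\<forall>P. eventually P F \<or> eventually (\<lambda>x. \<not> P x) F)"

definition nonprincipal_ultrafilter :: "'a filter \<Rightarrow> bool" where
  "nonprincipal_ultrafilter F \<longleftrightarrow> is_ultrafilter F \<and> (\<forall>A. F \<noteq> principal A)"

lemma nonprincipal_ultrafilter_iff:
  "nonprincipal_ultrafilter F \<longleftrightarrow> is_ultrafilter F \<and> (\<forall>a. \<not> eventually (\<lambda>x. x = a) F)"
proof -
  have "(\<exists>A. F = principal A) \<longleftrightarrow> (\<exists>a. eventually (\<lambda>x. x = a) F)" if F: "is_ultrafilter F"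
  proof
    assume "\<exists>A. F = principal A"
    then obtain A where A: "F = principal A" by blast
    with F obtain a where a: "a \<in> A"
      by (auto simp: is_ultrafilter_def principal_eq_bot_iff)
    have "eventually (\<lambda>x. x = a) F \<or> eventually (\<lambda>x. x \<noteq> a) F"
      using F by (auto simp: is_ultrafilter_def)
    with A a show "\<exists>a. eventually (\<lambda>x. x = a) F"
      by (auto simp: eventually_principal)
  next
    assume "\<exists>a. eventually (\<lambda>x. x = a) F"
    then obtain a where a: "eventually (\<lambda>x. x = a) F" by blast
    have "eventually P F \<longleftrightarrow> P a" for P
    proof
      assume "eventually P F"
      with a have "eventually (\<lambda>x. P x \<and> x = a) F"
        by (rule eventually_conj[rotated])
      then have "eventually (\<lambda>x. P a) F"
        by (rule eventually_mono) auto
      with F show "P a"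
        by (auto simp: is_ultrafilter_def eventually_const)
    next
      assume "P a"
      with a show "eventually P F"
        by (auto elim: eventually_mono)
    qed
    then have "F = principal {a}"
      by (simp add: filter_eq_iff eventually_principal)
    then show "\<exists>A. F = principal A" ..
  qed
  then show ?thesis
    by (auto simp: nonprincipal_ultrafilter_def)
qed

lemma ultrafilter_tendsto_compact:
  fixes f :: "'a \<Rightarrow> 'b::topological_space"
  assumes F: "is_ultrafilter F" and C: "compact C" and f: "eventually (\<lambda>x. f x \<in> C) F"
  shows "\<exists>l\<in>C. (f \<longlongrightarrow> l) F"
proof -
  have "filtermap f F \<noteq> bot"
    using F by (auto simp: is_ultrafilter_def filtermap_bot_iff)
  moreover have "eventually (\<lambda>y. y \<in> C) (filtermap f F)"
    using f by (simp add: eventually_filtermap)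
  ultimately obtain l where l: "l \<in> C" "inf (nhds l) (filtermap f F) \<noteq> bot"
    using C unfolding compact_filter by blast
  have "eventually P (filtermap f F)" if P: "eventually P (nhds l)" for P
  proof (rule ccontr)
    assume "\<not> ?thesis"
    with F have "eventually (\<lambda>y. \<not> P y) (filtermap f F)"
      by (auto simp: is_ultrafilter_def eventually_filtermap)
    with P have "eventually (\<lambda>y. False) (inf (nhds l) (filtermap f F))"
      unfolding eventually_inf by blast
    with l(2) show False
      by (simp add: trivial_limit_def)
  qed
  then have "(f \<longlongrightarrow> l) F"
    by (simp add: filterlim_def le_filter_def)
  with l(1) show ?thesis by blast
qed

section \<open>Free groups\<close>

text \<open>The letter \<open>(a, True)\<close> stands for the generator \<open>a\<close> and \<open>(a, False)\<close> for its inverse.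
  Elements of the free group are the reduced words; they are multiplied by concatenation followed
  by free reduction.\<close>

definition letter_inv :: "'a \<times> bool \<Rightarrow> 'a \<times> bool" where
  "letter_inv x = (fst x, \<not> snd x)"

definition reduced :: "('a \<times> bool) list \<Rightarrow> bool" where
  "reduced w \<longleftrightarrow> successively (\<lambda>x y. y \<noteq> letter_inv x) w"

fun cancel_Cons :: "'a \<times> bool \<Rightarrow> ('a \<times> bool) list \<Rightarrow> ('a \<times> bool) list" where
  "cancel_Cons x [] = [x]"
| "cancel_Cons x (y # w) = (if y = letter_inv x then w else x # y # w)"

definition free_group :: "'a set \<Rightarrow> ('a \<times> bool) list monoid" where
  "free_group S = \<lparr>carrier = {w. set w \<subseteq> S \<times> UNIV \<and> reduced w},
                   monoid.mult = (\<lambda>u v. foldr cancel_Cons u v),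
                   one = []\<rparr>"

lemma letter_inv_inv [simp]: "letter_inv (letter_inv x) = x"
  by (simp add: letter_inv_def)

lemma letter_inv_neq [simp]: "letter_inv x \<noteq> x" "x \<noteq> letter_inv x"
  by (auto simp: letter_inv_def prod_eq_iff)

lemma reduced_Nil [simp]: "reduced []"
  by (simp add: reduced_def)

lemma reduced_ConsD: "reduced (x # w) \<Longrightarrow> reduced w"
  by (cases w) (auto simp: reduced_def)

lemma cancel_Cons_reduced: "reduced w \<Longrightarrow> reduced (cancel_Cons x w)"
  by (cases w rule: list.exhaust) (auto simp: reduced_def successively_Cons)

lemma cancel_Cons_of_reduced: "reduced (x # w) \<Longrightarrow> cancel_Cons x w = x # w"
  by (cases w) (auto simp: reduced_def)

lemma cancel_Cons_inv: "reduced w \<Longrightarrow> cancel_Cons x (cancel_Cons (letter_inv x) w) = w"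
proof (cases w)
  case (Cons y w')
  assume "reduced w"
  then show ?thesis
    using Cons cancel_Cons_of_reduced[of y w'] by auto
qed simp

lemma set_cancel_Cons: "set (cancel_Cons x w) \<subseteq> insert x (set w)"
  by (cases w) auto

lemma foldr_cancel_Cons_reduced: "reduced v \<Longrightarrow> reduced (foldr cancel_Cons u v)"
  by (induction u) (auto simp: cancel_Cons_reduced)

lemma set_foldr_cancel_Cons: "set (foldr cancel_Cons u v) \<subseteq> set u \<union> set v"
proof (induction u)
  case (Cons x u)
  then show ?case
    using set_cancel_Cons[of x "foldr cancel_Cons u v"] by auto
qed auto

lemma foldr_cancel_Cons_Nil: "reduced u \<Longrightarrow> foldr cancel_Cons u [] = u"
proof (induction u)
  case (Cons x u)
  then show ?case
    using reduced_ConsD[OF Cons.prems] by (simp add: cancel_Cons_of_reduced)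
qed auto

lemma foldr_cancel_Cons_cancel_Cons:
  assumes "reduced w"
  shows "foldr cancel_Cons (cancel_Cons x u) w = cancel_Cons x (foldr cancel_Cons u w)"
proof (cases u)
  case (Cons y u')
  then show ?thesis
    using cancel_Cons_inv[OF foldr_cancel_Cons_reduced[OF assms, of u'], of x] by auto
qed auto

lemma foldr_cancel_Cons_assoc:
  assumes "reduced w"
  shows "foldr cancel_Cons (foldr cancel_Cons u v) w = foldr cancel_Cons u (foldr cancel_Cons v w)"
  by (induction u) (auto simp: foldr_cancel_Cons_cancel_Cons[OF assms])

lemma foldr_cancel_Cons_inverse:
  assumes "reduced w"
  shows "foldr cancel_Cons (map letter_inv (rev u)) (foldr cancel_Cons u w) = w"
  using assms
proof (induction u arbitrary: w)
  case (Cons x u)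
  have "cancel_Cons (letter_inv x) (cancel_Cons x (foldr cancel_Cons u w)) = foldr cancel_Cons u w"
    using cancel_Cons_inv[of "foldr cancel_Cons u w" "letter_inv x"]
    by (simp add: foldr_cancel_Cons_reduced Cons.prems)
  with Cons show ?case by simp
qed auto

theorem group_free_group: "group (free_group S)"
proof (rule groupI)
  fix u v assume "u \<in> carrier (free_group S)" "v \<in> carrier (free_group S)"
  then show "u \<otimes>\<^bsub>free_group S\<^esub> v \<in> carrier (free_group S)"
    using set_foldr_cancel_Cons[of u v] by (auto simp: free_group_def foldr_cancel_Cons_reduced)
next
  fix u assume u: "u \<in> carrier (free_group S)"
  let ?v = "foldr cancel_Cons (map letter_inv (rev u)) []"
  have "?v \<otimes>\<^bsub>free_group S\<^esub> u = \<one>\<^bsub>free_group S\<^esub>"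
  proof -
    have "foldr cancel_Cons ?v u = foldr cancel_Cons (map letter_inv (rev u)) u"
      using u foldr_cancel_Cons_assoc[of u "map letter_inv (rev u)" "[]"]
      by (simp add: free_group_def)
    also have "\<dots> = foldr cancel_Cons (map letter_inv (rev u)) (foldr cancel_Cons u [])"
      using u by (simp add: free_group_def foldr_cancel_Cons_Nil)
    also have "\<dots> = []"
      by (rule foldr_cancel_Cons_inverse) simp
    finally show ?thesis
      by (simp add: free_group_def)
  qed
  moreover have "?v \<in> carrier (free_group S)"
    using u set_foldr_cancel_Cons[of "map letter_inv (rev u)" "[]"]
    by (fastforce simp: free_group_def letter_inv_def foldr_cancel_Cons_reduced)
  ultimately show "\<exists>v\<in>carrier (free_group S). v \<otimes>\<^bsub>free_group S\<^esub> u = \<one>\<^bsub>free_group S\<^esub>"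
    by blast
qed (auto simp: free_group_def foldr_cancel_Cons_assoc)

theorem free_group_universal:
  assumes H: "group H" and f: "f \<in> S \<rightarrow> carrier H"
  shows "\<exists>h\<in>hom (free_group S) H. (\<forall>a\<in>S. h [(a, True)] = f a) \<and>
           (\<forall>h'\<in>hom (free_group S) H. (\<forall>a\<in>S. h' [(a, True)] = f a) \<longrightarrow>
              (\<forall>w\<in>carrier (free_group S). h' w = h w))"
proof -
  interpret H: group H by fact
  interpret F: group "free_group S" by (rule group_free_group)
  define g where "g x = (if snd x then f (fst x) else inv\<^bsub>H\<^esub> (f (fst x)))" for x
  define h where "h w = foldr (\<lambda>x z. g x \<otimes>\<^bsub>H\<^esub> z) w \<one>\<^bsub>H\<^esub>" for w
  have g_closed: "g x \<in> carrier H" if "x \<in> S \<times> UNIV" for x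
    using that f by (auto simp: g_def)
  have g_inv: "g x \<otimes>\<^bsub>H\<^esub> g (letter_inv x) = \<one>\<^bsub>H\<^esub>" if "x \<in> S \<times> UNIV" for x
    using that f by (auto simp: g_def letter_inv_def intro!: H.r_inv H.l_inv)
  have h_closed: "h w \<in> carrier H" if "set w \<subseteq> S \<times> UNIV" for w
    using that by (induction w) (auto simp: h_def intro!: H.m_closed g_closed)
  have h_cancel: "h (cancel_Cons x w) = g x \<otimes>\<^bsub>H\<^esub> h w"
    if "x \<in> S \<times> UNIV" "set w \<subseteq> S \<times> UNIV" for x w
  proof (cases w)
    case (Cons y w')
    show ?thesis
    proof (cases "y = letter_inv x")
      case True
      have y: "y \<in> S \<times> UNIV" and w': "set w' \<subseteq> S \<times> UNIV"
        using Cons that by auto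
      have "g x \<otimes>\<^bsub>H\<^esub> h w = g x \<otimes>\<^bsub>H\<^esub> (g y \<otimes>\<^bsub>H\<^esub> h w')"
        by (simp add: Cons h_def)
      also have "\<dots> = (g x \<otimes>\<^bsub>H\<^esub> g y) \<otimes>\<^bsub>H\<^esub> h w'"
        using H.m_assoc[OF g_closed[OF that(1)] g_closed[OF y] h_closed[OF w']] by simp
      also have "\<dots> = h w'"
        using g_inv[OF that(1)] True h_closed[OF w'] by simp
      finally show ?thesis
        using Cons True by simp
    qed (simp add: Cons h_def)
  qed (simp add: h_def)
  have h_mult: "h (foldr cancel_Cons u v) = h u \<otimes>\<^bsub>H\<^esub> h v"
    if "set u \<subseteq> S \<times> UNIV" "set v \<subseteq> S \<times> UNIV" for u v
    using that
  proof (induction u)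
    case Nil
    then show ?case using h_closed[of v] by (simp add: h_def)
  next
    case (Cons x u)
    have "set (foldr cancel_Cons u v) \<subseteq> S \<times> UNIV"
      using Cons.prems set_foldr_cancel_Cons[of u v] by auto
    then have "h (foldr cancel_Cons (x # u) v) = g x \<otimes>\<^bsub>H\<^esub> (h u \<otimes>\<^bsub>H\<^esub> h v)"
      using Cons by (simp add: h_cancel)
    also have "\<dots> = h (x # u) \<otimes>\<^bsub>H\<^esub> h v"
      using Cons.prems H.m_assoc[of "g x" "h u" "h v"] g_closed[of x] h_closed[of u] h_closed[of v]
      by (simp add: h_def)
    finally show ?case .
  qed
  have h_hom: "h \<in> hom (free_group S) H"
    by (rule homI) (auto simp: free_group_def h_closed h_mult)
  have h_gen: "h [(a, True)] = f a" if "a \<in> S" for a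
    using H.r_one[OF funcset_mem[OF f that]] by (simp add: h_def g_def)
  have unique: "h' w = h w"
    if h': "h' \<in> hom (free_group S) H" "\<forall>a\<in>S. h' [(a, True)] = f a"
      and w: "w \<in> carrier (free_group S)" for h' w
  proof -
    interpret h': group_hom "free_group S" H h'
      by standard (rule h'(1))
    have letter: "[x] \<in> carrier (free_group S)" "h' [x] = g x" if "x \<in> S \<times> UNIV" for x
    proof -
      show c: "[x] \<in> carrier (free_group S)"
        using that by (auto simp: free_group_def reduced_def)
      obtain a b where x: "x = (a, b)" "a \<in> S"
        using \<open>x \<in> S \<times> UNIV\<close> by blast
      show "h' [x] = g x"
      proof (cases b)
        case False
        have ca: "[(a, True)] \<in> carrier (free_group S)"
          using x by (auto simp: free_group_def reduced_def)
        have "[x] \<otimes>\<^bsub>free_group S\<^esub> [(a, True)] = \<one>\<^bsub>free_group S\<^esub>"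
          using x False by (simp add: free_group_def letter_inv_def)
        then have "[x] = inv\<^bsub>free_group S\<^esub> [(a, True)]"
          using F.inv_equality ca c by metis
        then show ?thesis
          using x False ca h'(2) by (simp add: g_def)
      qed (use x h'(2) in \<open>simp add: g_def\<close>)
    qed
    from w show ?thesis
    proof (induction w)
      case Nil
      then show ?case using h'.hom_one by (simp add: free_group_def h_def)
    next
      case (Cons x w)
      have x: "x \<in> S \<times> UNIV" and w: "w \<in> carrier (free_group S)"
        using Cons.prems reduced_ConsD by (auto simp: free_group_def)
      have "x # w = [x] \<otimes>\<^bsub>free_group S\<^esub> w"
        using Cons.prems by (simp add: free_group_def cancel_Cons_of_reduced)
      then have "h' (x # w) = h' [x] \<otimes>\<^bsub>H\<^esub> h' w"
        using letter(1)[OF x] w by simp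
      then show ?case
        using Cons.IH[OF w] letter(2)[OF x] by (simp add: h_def)
    qed
  qed
  show ?thesis
    using h_hom h_gen unique by blast
qed

text \<open>The two elements of \<^typ>\<open>bool\<close> serve as the free generators.\<close>

abbreviation free_group_2 :: "(bool \<times> bool) list monoid" where
  "free_group_2 \<equiv> free_group UNIV"

section \<open>The universal sofic group\<close>

definition hamming_dist :: "nat \<Rightarrow> (nat \<Rightarrow> nat) \<Rightarrow> (nat \<Rightarrow> nat) \<Rightarrow> real" where
  "hamming_dist n p q = real (card {i \<in> {1..n}. p i \<noteq> q i}) / real n"

abbreviation sym_product :: "(nat \<Rightarrow> nat) \<Rightarrow> (nat \<Rightarrow> nat \<Rightarrow> nat) monoid" where
  "sym_product n \<equiv> product_group UNIV (\<lambda>k. sym_group (n k))"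

definition sofic_kernel :: "nat filter \<Rightarrow> (nat \<Rightarrow> nat) \<Rightarrow> (nat \<Rightarrow> nat \<Rightarrow> nat) set" where
  "sofic_kernel \<omega> n = {p \<in> carrier (sym_product n).
     ((\<lambda>k. hamming_dist (n k) (p k) \<one>\<^bsub>sym_group (n k)\<^esub>) \<longlongrightarrow> 0) \<omega>}"

definition universal_sofic_group ::
    "nat filter \<Rightarrow> (nat \<Rightarrow> nat) \<Rightarrow> (nat \<Rightarrow> nat \<Rightarrow> nat) set monoid" where
  "universal_sofic_group \<omega> n = sym_product n Mod sofic_kernel \<omega> n"

text \<open>The distance of two classes is computed on arbitrary representatives; existence of the limit
  and independence of the representatives are proved in \<open>sofic_dist_tendsto\<close> below.\<close>

definition sofic_dist ::
    "nat filter \<Rightarrow> (nat \<Rightarrow> nat) \<Rightarrow> (nat \<Rightarrow> nat \<Rightarrow> nat) set \<Rightarrow> (nat \<Rightarrow> nat \<Rightarrow> nat) set \<Rightarrow> real" where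
  "sofic_dist \<omega> n P Q = (THE d. \<exists>p\<in>P. \<exists>q\<in>Q. ((\<lambda>k. hamming_dist (n k) (p k) (q k)) \<longlongrightarrow> d) \<omega>)"

definition sofic_representation ::
    "nat filter \<Rightarrow> (nat \<Rightarrow> nat) \<Rightarrow> ('g, 'b) monoid_scheme \<Rightarrow> ('g \<Rightarrow> (nat \<Rightarrow> nat \<Rightarrow> nat) set) \<Rightarrow> bool" where
  "sofic_representation \<omega> n G \<theta> \<longleftrightarrow>
     \<theta> \<in> hom G (universal_sofic_group \<omega> n) \<and>
     (\<forall>g\<in>carrier G. g \<noteq> \<one>\<^bsub>G\<^esub> \<longrightarrow> sofic_dist \<omega> n (\<theta> g) \<one>\<^bsub>universal_sofic_group \<omega> n\<^esub> = 1)"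

definition commutant :: "('g, 'b) monoid_scheme \<Rightarrow> 'g set \<Rightarrow> 'g set" where
  "commutant G A = {p \<in> carrier G. \<forall>a\<in>A. p \<otimes>\<^bsub>G\<^esub> a = a \<otimes>\<^bsub>G\<^esub> p}"

lemma hamming_dist_nonneg: "0 \<le> hamming_dist n p q"
  by (simp add: hamming_dist_def)

lemma hamming_dist_le_1: "hamming_dist n p q \<le> 1"
proof -
  have "card {i \<in> {1..n}. p i \<noteq> q i} \<le> card {1..n}"
    by (rule card_mono) auto
  then show ?thesis
    by (auto simp: hamming_dist_def divide_le_eq_1)
qed

lemma hamming_dist_self [simp]: "hamming_dist n p p = 0"
  by (simp add: hamming_dist_def)

lemma hamming_dist_commute: "hamming_dist n p q = hamming_dist n q p"
  unfolding hamming_dist_def by (metis (mono_tags, lifting))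

lemma hamming_dist_triangle: "hamming_dist n p r \<le> hamming_dist n p q + hamming_dist n q r"
proof -
  have "card {i \<in> {1..n}. p i \<noteq> r i} \<le> card ({i \<in> {1..n}. p i \<noteq> q i} \<union> {i \<in> {1..n}. q i \<noteq> r i})"
    by (rule card_mono) auto
  also have "\<dots> \<le> card {i \<in> {1..n}. p i \<noteq> q i} + card {i \<in> {1..n}. q i \<noteq> r i}"
    by (rule card_Un_le)
  finally have "real (card {i \<in> {1..n}. p i \<noteq> r i})
      \<le> real (card {i \<in> {1..n}. p i \<noteq> q i}) + real (card {i \<in> {1..n}. q i \<noteq> r i})"
    unfolding of_nat_add[symmetric] by (rule of_nat_mono)
  then show ?thesis
    unfolding hamming_dist_def add_divide_distrib[symmetric] by (rule divide_right_mono) simp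
qed

lemma hamming_dist_left:
  assumes "s permutes {1..n}"
  shows "hamming_dist n (s \<circ> p) (s \<circ> q) = hamming_dist n p q"
  by (simp add: hamming_dist_def inj_eq[OF permutes_inj[OF assms]])

lemma hamming_dist_right:
  assumes s: "s permutes {1..n}"
  shows "hamming_dist n (p \<circ> s) (q \<circ> s) = hamming_dist n p q"
proof -
  have "bij_betw s {i \<in> {1..n}. p (s i) \<noteq> q (s i)} {i \<in> {1..n}. p i \<noteq> q i}"
    unfolding bij_betw_def
  proof
    show "inj_on s {i \<in> {1..n}. p (s i) \<noteq> q (s i)}"
      using permutes_inj[OF s] by (rule inj_on_subset) auto
    show "s ` {i \<in> {1..n}. p (s i) \<noteq> q (s i)} = {i \<in> {1..n}. p i \<noteq> q i}"
    proof safe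
      fix i assume "i \<in> {1..n}" then show "s i \<in> {1..n}"
        using permutes_in_image[OF s] by simp
    next
      fix i assume i: "i \<in> {1..n}" "p i \<noteq> q i"
      obtain j where j: "j \<in> {1..n}" "i = s j"
        using permutes_image[OF s] i(1) by blast
      with i show "i \<in> s ` {i \<in> {1..n}. p (s i) \<noteq> q (s i)}" by blast
    qed
  qed
  then show ?thesis
    by (simp add: hamming_dist_def bij_betw_same_card)
qed

lemma group_sym_product: "group (sym_product n)"
  by (simp add: sym_group_is_group)

lemma sym_product_carrier: "p \<in> carrier (sym_product n) \<longleftrightarrow> (\<forall>k. p k permutes {1..n k})"
  by (simp add: PiE_iff sym_group_carrier)

lemma sym_product_mult: "(p \<otimes>\<^bsub>sym_product n\<^esub> q) k = p k \<circ> q k"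
  by (simp add: sym_group_mult)

lemma sym_product_one: "\<one>\<^bsub>sym_product n\<^esub> k = id"
  by (simp add: sym_group_one)

lemma sofic_kernel_iff:
  "p \<in> sofic_kernel \<omega> n \<longleftrightarrow>
     p \<in> carrier (sym_product n) \<and> ((\<lambda>k. hamming_dist (n k) (p k) id) \<longlongrightarrow> 0) \<omega>"
  by (simp add: sofic_kernel_def sym_group_one)

lemma tendsto_0_hamming_mono:
  assumes "((\<lambda>k. f k) \<longlongrightarrow> 0) \<omega>" "\<And>k. hamming_dist (n k) (p k) (q k) \<le> f k"
  shows "((\<lambda>k. hamming_dist (n k) (p k) (q k)) \<longlongrightarrow> (0::real)) \<omega>"
  by (rule tendsto_sandwich[OF _ _ tendsto_const assms(1)])
     (simp_all add: hamming_dist_nonneg assms(2))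

lemma sofic_kernel_normal: "sofic_kernel \<omega> n \<lhd> sym_product n"
proof -
  interpret P: group "sym_product n" by (rule group_sym_product)
  have inv_comp: "(inv\<^bsub>sym_product n\<^esub> x) k \<circ> x k = id" "x k \<circ> (inv\<^bsub>sym_product n\<^esub> x) k = id"
    if "x \<in> carrier (sym_product n)" for x k
    using P.l_inv[OF that] P.r_inv[OF that]
      sym_product_mult[of n "inv\<^bsub>sym_product n\<^esub> x" x k] sym_product_mult[of n x "inv\<^bsub>sym_product n\<^esub> x" k]
      sym_product_one[of n k]
    by simp_all
  have perm: "x k permutes {1..n k}" if "x \<in> carrier (sym_product n)" for x k
    using that by (simp only: sym_product_carrier)
  have "subgroup (sofic_kernel \<omega> n) (sym_product n)"
  proof (rule P.subgroupI)
    show "sofic_kernel \<omega> n \<subseteq> carrier (sym_product n)"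
      by (auto simp only: sofic_kernel_iff)
    have "\<one>\<^bsub>sym_product n\<^esub> \<in> sofic_kernel \<omega> n"
      using P.one_closed tendsto_const
      by (simp only: sofic_kernel_iff sym_product_one hamming_dist_self simp_thms)
    then show "sofic_kernel \<omega> n \<noteq> {}" by blast
  next
    fix p assume p: "p \<in> sofic_kernel \<omega> n"
    then have pc: "p \<in> carrier (sym_product n)" by (simp only: sofic_kernel_iff)
    have "hamming_dist (n k) ((inv\<^bsub>sym_product n\<^esub> p) k) id = hamming_dist (n k) (p k) id" for k
      using hamming_dist_right[OF perm[OF pc], where p = "(inv\<^bsub>sym_product n\<^esub> p) k" and q = id, of k]
        inv_comp[OF pc]
      by (simp only: id_o hamming_dist_commute)
    then show "inv\<^bsub>sym_product n\<^esub> p \<in> sofic_kernel \<omega> n"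
      using p P.inv_closed[OF pc] by (simp only: sofic_kernel_iff)
  next
    fix p q assume pq: "p \<in> sofic_kernel \<omega> n" "q \<in> sofic_kernel \<omega> n"
    have c: "p \<in> carrier (sym_product n)" "q \<in> carrier (sym_product n)"
      using pq by (simp_all only: sofic_kernel_iff)
    have lim: "((\<lambda>k. hamming_dist (n k) (p k) id + hamming_dist (n k) (q k) id) \<longlongrightarrow> 0) \<omega>"
      using tendsto_add[of _ 0 \<omega> _ 0] pq by (auto simp only: sofic_kernel_iff add_0)
    have "((\<lambda>k. hamming_dist (n k) ((p \<otimes>\<^bsub>sym_product n\<^esub> q) k) (id :: nat \<Rightarrow> nat)) \<longlongrightarrow> 0) \<omega>"
    proof (rule tendsto_0_hamming_mono[OF lim])
      fix k
      have "hamming_dist (n k) (p k \<circ> q k) id \<le> hamming_dist (n k) (p k \<circ> q k) (p k) + hamming_dist (n k) (p k) id"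
        by (rule hamming_dist_triangle)
      also have "hamming_dist (n k) (p k \<circ> q k) (p k) = hamming_dist (n k) (q k) id"
        using hamming_dist_left[OF perm[OF c(1)], where p = "q k" and q = id, of k] by simp
      finally show "hamming_dist (n k) ((p \<otimes>\<^bsub>sym_product n\<^esub> q) k) id
          \<le> hamming_dist (n k) (p k) id + hamming_dist (n k) (q k) id"
        unfolding sym_product_mult by (simp only: add.commute)
    qed
    then show "p \<otimes>\<^bsub>sym_product n\<^esub> q \<in> sofic_kernel \<omega> n"
      using P.m_closed[OF c] by (simp only: sofic_kernel_iff)
  qed
  then show ?thesis
  proof (rule P.normal_invI)
    fix x h assume x: "x \<in> carrier (sym_product n)" and h: "h \<in> sofic_kernel \<omega> n"
    have hc: "h \<in> carrier (sym_product n)" using h by (simp only: sofic_kernel_iff)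
    let ?y = "inv\<^bsub>sym_product n\<^esub> x"
    have "hamming_dist (n k) ((x \<otimes>\<^bsub>sym_product n\<^esub> h \<otimes>\<^bsub>sym_product n\<^esub> ?y) k) id
        = hamming_dist (n k) (h k) id" for k
    proof -
      have "hamming_dist (n k) (x k \<circ> h k \<circ> ?y k) id
          = hamming_dist (n k) (x k \<circ> h k \<circ> ?y k \<circ> x k) (id \<circ> x k)"
        using hamming_dist_right[OF perm[OF x]] by metis
      also have "x k \<circ> h k \<circ> ?y k \<circ> x k = x k \<circ> h k"
        by (simp only: comp_assoc inv_comp[OF x] comp_id)
      also have "hamming_dist (n k) (x k \<circ> h k) (id \<circ> x k) = hamming_dist (n k) (x k \<circ> h k) (x k \<circ> id)"
        by simp
      also have "\<dots> = hamming_dist (n k) (h k) id"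
        by (rule hamming_dist_left[OF perm[OF x]])
      finally show ?thesis by (simp only: sym_product_mult)
    qed
    then show "x \<otimes>\<^bsub>sym_product n\<^esub> h \<otimes>\<^bsub>sym_product n\<^esub> ?y \<in> sofic_kernel \<omega> n"
      using h P.m_closed[OF P.m_closed[OF x hc] P.inv_closed[OF x]] by (simp only: sofic_kernel_iff)
  qed
qed

theorem group_universal_sofic_group: "group (universal_sofic_group \<omega> n)"
  unfolding universal_sofic_group_def
  by (rule normal.factorgroup_is_group[OF sofic_kernel_normal])

lemma sofic_coset_dist:
  assumes "p \<in> carrier (sym_product n)" "p' \<in> sofic_kernel \<omega> n #>\<^bsub>sym_product n\<^esub> p"
  shows "((\<lambda>k. hamming_dist (n k) (p' k) (p k)) \<longlongrightarrow> 0) \<omega>"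
proof -
  obtain h where h: "h \<in> sofic_kernel \<omega> n" "p' = h \<otimes>\<^bsub>sym_product n\<^esub> p"
    using assms(2) unfolding r_coset_def by blast
  have "hamming_dist (n k) (p' k) (p k) = hamming_dist (n k) (h k) id" for k
    using hamming_dist_right[of "p k" "n k" "h k" id] assms(1)
    by (simp only: h(2) sym_product_mult sym_product_carrier id_o)
  with h(1) show ?thesis by (simp only: sofic_kernel_iff)
qed

theorem sofic_dist_tendsto:
  assumes \<omega>: "is_ultrafilter \<omega>"
    and p: "p \<in> carrier (sym_product n)" and q: "q \<in> carrier (sym_product n)"
  shows "((\<lambda>k. hamming_dist (n k) (p k) (q k)) \<longlongrightarrow>
           sofic_dist \<omega> n (sofic_kernel \<omega> n #>\<^bsub>sym_product n\<^esub> p) (sofic_kernel \<omega> n #>\<^bsub>sym_product n\<^esub> q)) \<omega>"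
    (is "(?f \<longlongrightarrow> sofic_dist \<omega> n ?P ?Q) \<omega>")
proof -
  have nb: "\<omega> \<noteq> bot" using \<omega> by (simp add: is_ultrafilter_def)
  obtain d where d: "(?f \<longlongrightarrow> d) \<omega>"
    using ultrafilter_tendsto_compact[OF \<omega>, of "{0..1}" ?f]
    by (auto simp: hamming_dist_nonneg hamming_dist_le_1)
  have sub: "subgroup (sofic_kernel \<omega> n) (sym_product n)"
    using sofic_kernel_normal by (rule normal_imp_subgroup)
  have self: "p \<in> ?P" "q \<in> ?Q"
    using group.rcos_self[OF group_sym_product _ sub] p q by blast+
  have uniq: "d' = d"
    if p': "p' \<in> ?P" and q': "q' \<in> ?Q"
      and d': "((\<lambda>k. hamming_dist (n k) (p' k) (q' k)) \<longlongrightarrow> d') \<omega>" for p' q' d'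
  proof -
    have lim: "((\<lambda>k. hamming_dist (n k) (p' k) (p k) + hamming_dist (n k) (q' k) (q k)) \<longlongrightarrow> 0) \<omega>"
      using tendsto_add[OF sofic_coset_dist[OF p p'] sofic_coset_dist[OF q q']] by simp
    have le: "\<bar>hamming_dist (n k) (p' k) (q' k) - ?f k\<bar>
        \<le> hamming_dist (n k) (p' k) (p k) + hamming_dist (n k) (q' k) (q k)" for k
      using hamming_dist_triangle[of "n k" "p' k" "q' k" "p k"]
        hamming_dist_triangle[of "n k" "p k" "q' k" "q k"]
        hamming_dist_triangle[of "n k" "p k" "q k" "p' k"]
        hamming_dist_triangle[of "n k" "p' k" "q k" "q' k"]
        hamming_dist_commute[of "n k" "p k" "p' k"] hamming_dist_commute[of "n k" "q k" "q' k"]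
      by linarith
    have "((\<lambda>k. hamming_dist (n k) (p' k) (q' k) - ?f k) \<longlongrightarrow> 0) \<omega>"
      by (rule Lim_null_comparison[OF _ lim]) (simp add: le)
    moreover have "((\<lambda>k. hamming_dist (n k) (p' k) (q' k) - ?f k) \<longlongrightarrow> d' - d) \<omega>"
      by (rule tendsto_diff[OF d' d])
    ultimately show ?thesis
      using tendsto_unique[OF nb] by fastforce
  qed
  have "sofic_dist \<omega> n ?P ?Q = d"
    unfolding sofic_dist_def
    by (rule the_equality) (use self d uniq in blast)+
  with d show ?thesis by simp
qed

theorem sofic_representation_inj:
  assumes \<omega>: "is_ultrafilter \<omega>" and G: "group G" and \<theta>: "sofic_representation \<omega> n G \<theta>"
  shows "inj_on \<theta> (carrier G)"
proof -
  let ?U = "universal_sofic_group \<omega> n"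
  interpret h: group_hom G ?U \<theta>
    using G group_universal_sofic_group \<theta>
    by (simp add: group_hom_def group_hom_axioms_def sofic_representation_def)
  have nb: "\<omega> \<noteq> bot" using \<omega> by (simp add: is_ultrafilter_def)
  interpret P: group "sym_product n" by (rule group_sym_product)
  have one: "\<one>\<^bsub>?U\<^esub> = sofic_kernel \<omega> n #>\<^bsub>sym_product n\<^esub> \<one>\<^bsub>sym_product n\<^esub>"
    using P.coset_mult_one[OF subgroup.subset[OF normal_imp_subgroup[OF sofic_kernel_normal]]]
    by (simp only: universal_sofic_group_def one_FactGroup)
  have "((\<lambda>k::nat. 0::real) \<longlongrightarrow> sofic_dist \<omega> n \<one>\<^bsub>?U\<^esub> \<one>\<^bsub>?U\<^esub>) \<omega>"
    using sofic_dist_tendsto[OF \<omega> P.one_closed P.one_closed]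
    unfolding one hamming_dist_self .
  then have "sofic_dist \<omega> n \<one>\<^bsub>?U\<^esub> \<one>\<^bsub>?U\<^esub> = 0"
    using tendsto_unique[OF nb _ tendsto_const] by blast
  then have "\<forall>g\<in>carrier G. \<theta> g = \<one>\<^bsub>?U\<^esub> \<longrightarrow> g = \<one>\<^bsub>G\<^esub>"
    using \<theta> by (auto simp: sofic_representation_def)
  then have "kernel G ?U \<theta> = {\<one>\<^bsub>G\<^esub>}"
    by (auto simp: kernel_def)
  then show ?thesis
    by (simp only: h.inj_iff_trivial_ker)
qed

end

theory Submission
  imports Defs
begin

text \<open>
  The representation comes from random pairs of permutations.  A pair \<open>c\<close> of permutations of
  \<open>{1..n}\<close>, indexed by the two generators, makes every word act on \<open>{1..n}\<close>; a sequence of such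
  pairs defines a homomorphism from the free group to the universal sofic group.  Two properties of
  the sequence are needed, and each holds with probability tending to \<open>1\<close> as \<open>n\<close> grows.

  Freeness: a fixed nontrivial reduced word fixes only a small proportion of the points.  Follow a
  point letter by letter.  As long as its trajectory is injective, the next letter of a reduced word asks
  for a value of the random permutations that is still undetermined, so a return to one of the boundedly many
  points visited before has probability \<open>O(1 / n)\<close>.  In counting form this is a switching argument
  (\<open>trajectory_switch\<close>, \<open>card_first_return\<close>).

  Rigidity: for each \<open>r\<close>, every permutation \<open>p\<close> that commutes with both members of the pair, up to about
  \<open>n / (24 * r)\<close> points, moves at most \<open>n / r\<close> points.  Let \<open>A p\<close> be the number of permutations that
  almost commute with \<open>p\<close>.  The number of pairs that are not rigid is at most the sum of \<open>(A p)\<^sup>2\<close> over all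
  \<open>p\<close> with large support.  For such \<open>p\<close>, commutation determines many values of the
  commuting permutation from others, so \<open>A p\<close> is smaller than \<open>n!\<close> by a superexponential factor
  (\<open>card_almost_centralizer\<close>).  On the other hand, the sum of all \<open>A p\<close> counts almost commuting pairs.  The number of
  commuting pairs is \<open>n!\<close> times the number of conjugacy classes, hence at most \<open>2 ^ n * n!\<close>, and the errors
  allowed in almost commuting pairs cost only a moderate further factor (\<open>sum_card_almost_centralizer\<close>).
  Together the proportion of pairs that are not rigid tends to \<open>0\<close> (\<open>card_not_rigid\<close>, \<open>generic_rigid\<close>).

  A diagonal choice (\<open>generic_diagonal\<close>) gives one sequence of pairs that eventually satisfies each
  of these countably many requirements.  Freeness gives distance \<open>1\<close> from the identity for nontrivial words,
  and rigidity forces every element of the commutant to be at distance \<open>0\<close> from the identity.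
\<close>

section \<open>Words acting through pairs of permutations\<close>

definition perm_pairs :: "nat \<Rightarrow> (bool \<Rightarrow> nat \<Rightarrow> nat) set" where
  "perm_pairs n = {c. \<forall>s. c s permutes {1..n}}"

definition letter_act :: "('g \<Rightarrow> 'a \<Rightarrow> 'a) \<Rightarrow> 'g \<times> bool \<Rightarrow> 'a \<Rightarrow> 'a" where
  "letter_act c l = (if snd l then c (fst l) else inv_into UNIV (c (fst l)))"

definition word_act :: "('g \<Rightarrow> 'a \<Rightarrow> 'a) \<Rightarrow> ('g \<times> bool) list \<Rightarrow> 'a \<Rightarrow> 'a" where
  "word_act c w = foldr (\<lambda>l p. letter_act c l \<circ> p) w id"

lemma word_act_Nil [simp]: "word_act c [] = id"
  and word_act_Cons [simp]: "word_act c (l # w) = letter_act c l \<circ> word_act c w"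
  by (simp_all add: word_act_def)

lemma perm_pairs_eq_PiE: "perm_pairs n = (UNIV \<rightarrow>\<^sub>E {p. p permutes {1..n}})"
  by (auto simp: perm_pairs_def)

lemma card_families_bool:
  "card {c :: bool \<Rightarrow> 'a. \<forall>s. c s \<in> A} = (card A)\<^sup>2"
proof -
  have "{c :: bool \<Rightarrow> 'a. \<forall>s. c s \<in> A} = (UNIV \<rightarrow>\<^sub>E A)"
    by auto
  then show ?thesis
    by (simp add: card_PiE)
qed

lemma card_perms: "card {p. p permutes {1..n}} = fact n"
  by (rule card_permutations) simp_all

lemma card_perm_pairs: "card (perm_pairs n) = (fact n)\<^sup>2"
  using card_families_bool[of "{p. p permutes {1..n}}"]
  by (simp only: perm_pairs_def mem_Collect_eq card_perms)

lemma finite_perm_pairs: "finite (perm_pairs n)"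
  unfolding perm_pairs_eq_PiE by (intro finite_PiE) (auto intro: finite_permutations)

lemma letter_act_permutes:
  assumes "c \<in> perm_pairs n"
  shows "letter_act c l permutes {1..n}"
  using assms by (auto simp: letter_act_def perm_pairs_def intro: permutes_inv)

lemma word_act_permutes:
  assumes "c \<in> perm_pairs n"
  shows "word_act c w permutes {1..n}"
proof (induction w)
  case Nil
  then show ?case by (simp add: permutes_def)
next
  case (Cons l w)
  show ?case
    unfolding word_act_Cons by (rule permutes_compose[OF Cons letter_act_permutes[OF assms]])
qed

lemma letter_act_inverse:
  assumes "c \<in> perm_pairs n"
  shows "letter_act c l \<circ> letter_act c (letter_inv l) = id"
  using assms
  by (cases "snd l")
     (auto simp: letter_act_def perm_pairs_def letter_inv_def intro: permutes_inv_o)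

lemma word_act_cancel_Cons:
  assumes "c \<in> perm_pairs n"
  shows "word_act c (cancel_Cons l w) = letter_act c l \<circ> word_act c w"
proof (cases w)
  case (Cons l' w')
  show ?thesis
  proof (cases "l' = letter_inv l")
    case True
    then show ?thesis
      using Cons letter_act_inverse[OF assms, of l] by (simp flip: comp_assoc)
  qed (simp add: Cons)
qed simp

lemma word_act_mult:
  assumes "c \<in> perm_pairs n"
  shows "word_act c (foldr cancel_Cons u v) = word_act c u \<circ> word_act c v"
  by (induction u) (simp_all add: word_act_cancel_Cons[OF assms] comp_assoc)

section \<open>Short words rarely fix a point\<close>

text \<open>The points visited by \<open>x\<close> under the suffixes of \<open>w\<close>, the last one first, so that
  the head is the image of \<open>x\<close> under the whole word.  A word other than the empty one that
  fixes \<open>x\<close> has a trajectory that returns to its start; bounding the returns is easier than bounding the fixed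
  points directly because it can be done letter by letter.\<close>

fun trajectory :: "('g \<Rightarrow> 'a \<Rightarrow> 'a) \<Rightarrow> ('g \<times> bool) list \<Rightarrow> 'a \<Rightarrow> 'a list" where
  "trajectory c [] x = [x]"
| "trajectory c (l # w) x = word_act c (l # w) x # trajectory c w x"

lemma length_trajectory [simp]: "length (trajectory c w x) = Suc (length w)"
  by (induction w) auto

lemma word_act_in_trajectory: "word_act c w x \<in> set (trajectory c w x)"
  by (cases w) auto

lemma start_in_trajectory: "x \<in> set (trajectory c w x)"
  by (induction w) auto

lemma suffix_in_trajectory: "word_act c u x \<in> set (trajectory c (t @ u) x)"
  by (induction t) (auto simp: word_act_in_trajectory)

lemma distinct_trajectory_suffix:
  assumes "distinct (trajectory c (t @ u) x)" "word_act c u x = word_act c (t @ u) x"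
  shows "t = []"
proof (cases t)
  case (Cons l t')
  then show ?thesis
    using assms suffix_in_trajectory[of c u x t'] by auto
qed simp

text \<open>Rerouting: for an involution \<open>t\<close> the permutation attached to the generator of \<open>l\<close>
  is changed in such a way that the letter \<open>l\<close> acts as before followed by \<open>t\<close>.\<close>

definition switch :: "'g \<times> bool \<Rightarrow> ('a \<Rightarrow> 'a) \<Rightarrow> ('g \<Rightarrow> 'a \<Rightarrow> 'a) \<Rightarrow> 'g \<Rightarrow> 'a \<Rightarrow> 'a" where
  "switch l t c = c(fst l := (if snd l then t \<circ> c (fst l) else c (fst l) \<circ> t))"

lemma letter_act_switch:
  assumes c: "bij (c (fst l))" and t: "t \<circ> t = id"
  shows "letter_act (switch l t c) l =  t \<circ> letter_act c l"
    and "letter_act (switch l t c) (letter_inv l) = letter_act c (letter_inv l) \<circ> t"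
    and "l' \<noteq> l \<Longrightarrow> l' \<noteq> letter_inv l \<Longrightarrow> letter_act (switch l t c) l' = letter_act c l'"
proof -
  have t': "bij t" "inv_into UNIV t = t"
    using t by (auto intro: o_bij inv_unique_comp)
  show "letter_act (switch l t c) l =  t \<circ> letter_act c l"
    "letter_act (switch l t c) (letter_inv l) = letter_act c (letter_inv l) \<circ> t"
    using c t' by (auto simp: letter_act_def switch_def letter_inv_def o_inv_distrib)
  show "l' \<noteq> l \<Longrightarrow> l' \<noteq> letter_inv l \<Longrightarrow> letter_act (switch l t c) l' = letter_act c l'"
    by (cases l; cases l') (auto simp: letter_act_def switch_def letter_inv_def)
qed

lemma switch_switch:
  assumes "t \<circ> t = id"
  shows "switch l t (switch l t c) = c"
  using assms by (auto simp: switch_def fun_eq_iff)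

text \<open>If the letter \<open>l\<close> sends the current end of an injective trajectory back to an
  earlier point \<open>y\<close>, redirecting that single edge to a fresh point \<open>z\<close> leaves the trajectory itself unchanged.
  The modified action differs from the old one only where \<open>l\<close> takes the value
  \<open>y\<close> or \<open>z\<close>.  The value \<open>z\<close> does not occur on the trajectory, and the edge into \<open>y\<close>
  was not traversed before: in the forward direction because the trajectory is injective, and in
  the backward direction because \<open>l # w\<close> is reduced.\<close>

lemma trajectory_switch:
  assumes c: "\<And>s. bij (c s)" and red: "reduced (l # w)"
    and dist: "distinct (trajectory c w x)"
    and y: "letter_act c l (word_act c w x) = y" "y \<in> set (trajectory c w x)"
    and z: "z \<notin> set (trajectory c w x)"
  shows "trajectory (switch l (Transposition.transpose y z) c) w x = trajectory c w x"
proof -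
  let ?t = "Transposition.transpose y z"
  let ?c = "switch l ?t c"
  have tt: "?t \<circ> ?t = id" by (rule transpose_comp_involutory)
  have act: "letter_act ?c l =  ?t \<circ> letter_act c l"
    "letter_act ?c (letter_inv l) = letter_act c (letter_inv l) \<circ> ?t"
    "l' \<noteq> l \<Longrightarrow> l' \<noteq> letter_inv l \<Longrightarrow> letter_act ?c l' = letter_act c l'" for l'
    by (fact letter_act_switch(1)[OF c tt] letter_act_switch(2)[OF c tt] letter_act_switch(3)[OF c tt])+
  have inj: "inj (letter_act c l)"
    using c by (auto simp: letter_act_def bij_is_inj bij_imp_bij_inv)
  have linv: "letter_act c (letter_inv l) y = word_act c w x"
    unfolding y(1)[symmetric] using c[of "fst l"]
    by (auto simp: letter_act_def letter_inv_def bij_is_inj bij_is_surj surj_f_inv_f)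
  have "word_act ?c u x = word_act c u x \<and> trajectory ?c u x = trajectory c u x" if "w = t @ u" for t u
    using that
  proof (induction u arbitrary: t)
    case (Cons l' u)
    let ?h = "word_act c u x"
    have IH: "word_act ?c u x = ?h" "trajectory ?c u x = trajectory c u x"
      using Cons.IH[of "t @ [l']"] Cons.prems by auto
    have in1: "?h \<in> set (trajectory c w x)" "word_act c (l' # u) x \<in> set (trajectory c w x)"
      using suffix_in_trajectory[of c u x "t @ [l']"] suffix_in_trajectory[of c "l' # u" x t] Cons.prems
      by auto
    have h_ne: "?h \<noteq> word_act c w x"
      using distinct_trajectory_suffix[of c "t @ [l']" u x] Cons.prems dist by auto
    have "letter_act ?c l' ?h = letter_act c l' ?h"
    proof -
      consider "l' = l" | "l' = letter_inv l" | "l' \<noteq> l" "l' \<noteq> letter_inv l" by blast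
      then show ?thesis
      proof cases
        \<comment> \<open>the edge into \<open>y\<close> starts at the end of the trajectory, which \<open>u\<close> has not reached\<close>
        case 1
        have "letter_act c l ?h \<noteq> y"
          using h_ne inj y(1) by (auto dest: injD)
        moreover have "letter_act c l ?h \<noteq> z"
          using in1(2) z 1 by auto
        ultimately show ?thesis
          using 1 act(1) by (simp add: transpose_apply_other)
      next
        \<comment> \<open>leaving \<open>y\<close> backwards along that edge would end the trajectory by cancelling \<open>l\<close>\<close>
        case 2
        have "?h \<noteq> y"
        proof
          assume "?h = y"
          then have "word_act c (l' # u) x = word_act c w x"
            using linv 2 by simp
          then have "t = []"
            using dist unfolding Cons.prems by (intro distinct_trajectory_suffix)
          then have "w = letter_inv l # u"
            using 2 Cons.prems by simp
          then show False
            using red by (simp add: reduced_def)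
        qed
        moreover have "?h \<noteq> z"
          using in1(1) z by auto
        ultimately show ?thesis
          using 2 act(2) by (simp add: transpose_apply_other)
      next
        case 3
        then show ?thesis using act(3) by simp
      qed
    qed
    then show ?case
      using IH by simp
  qed simp
  then show ?thesis by (metis append_Nil)
qed

lemma switch_in_perm_pairs:
  assumes "c \<in> perm_pairs n" "y \<in> {1..n}" "z \<in> {1..n}"
  shows "switch l (Transposition.transpose y z) c \<in> perm_pairs n"
proof -
  have "Transposition.transpose y z permutes {1..n}"
    using assms by (intro permutes_swap_id)
  then show ?thesis
    using assms(1) by (auto simp: perm_pairs_def switch_def intro: permutes_compose)
qed

lemma trajectory_in_range:
  assumes "c \<in> perm_pairs n" "x \<in> {1..n}"
  shows "set (trajectory c w x) \<subseteq> {1..n}"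
proof (induction w)
  case (Cons l w)
  have "word_act c (l # w) x \<in> {1..n}"
    using permutes_in_image[OF word_act_permutes[OF assms(1), of "l # w"]] assms(2) by blast
  then show ?case using Cons by auto
qed (use assms in simp)

text \<open>Every pair for which the letter \<open>l\<close> closes the trajectory at position \<open>i\<close> can be
  rerouted to each of the \<open>n - length w - 1\<close> points off the trajectory.  Different choices give different
  pairs: the rerouted pair still shows the trajectory, hence \<open>y\<close>, and it shows \<open>z\<close> as the new
  end point, so the rerouting can be undone.  The conjunct \<open>i \<le> length w\<close> keeps the
  index within the trajectory.\<close>

lemma card_first_return:
  assumes red: "reduced (l # w)" and x: "x \<in> {1..n}"
  shows "card {c \<in> perm_pairs n. distinct (trajectory c w x) \<and> word_act c (l # w) x = trajectory c w x ! i \<and> i \<le> length w}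
      * (n - Suc (length w)) \<le> card (perm_pairs n)" (is "card ?A * _ \<le> _")
proof -
  define fresh where "fresh c = {1..n} - set (trajectory c w x)" for c
  have fin: "finite ?A" using finite_perm_pairs[of n] by simp
  have card_fresh: "card (fresh c) = n - Suc (length w)" if "c \<in> ?A" for c
  proof -
    have "set (trajectory c w x) \<subseteq> {1..n}" "distinct (trajectory c w x)"
      using that trajectory_in_range x by auto
    then show ?thesis
      by (simp add: fresh_def card_Diff_subset distinct_card)
  qed
  define f where "f = (\<lambda>(c, z). switch l (Transposition.transpose (trajectory c w x ! i) z) c)"
  have step: "f (c, z) \<in> perm_pairs n \<and> trajectory (f (c, z)) w x = trajectory c w x
      \<and> word_act (f (c, z)) (l # w) x = z
      \<and> switch l (Transposition.transpose (trajectory c w x ! i) z) (f (c, z)) = c" if c: "c \<in> ?A" and z: "z \<in> fresh c" for c z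
  proof -
    let ?y = "trajectory c w x ! i"
    let ?t = "Transposition.transpose ?y z"
    have bij: "bij (c s)" for s
      using c by (auto simp: perm_pairs_def intro: permutes_bij)
    have y: "letter_act c l (word_act c w x) = ?y" "?y \<in> set (trajectory c w x)"
      using c by auto
    have trajectory: "trajectory (f (c, z)) w x = trajectory c w x"
      unfolding f_def prod.case
      by (rule trajectory_switch[OF bij red _ y]) (use c z in \<open>auto simp: fresh_def\<close>)
    have "word_act (f (c, z)) w x = word_act c w x"
      using arg_cong[OF trajectory, of hd] by (cases w) auto
    moreover have "letter_act (f (c, z)) l = ?t \<circ> letter_act c l"
      unfolding f_def prod.case
      by (rule letter_act_switch(1)[OF bij transpose_comp_involutory])
    ultimately have "word_act (f (c, z)) (l # w) x = z"
      using y by simp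
    moreover have "f (c, z) \<in> perm_pairs n"
      unfolding f_def prod.case
    proof (rule switch_in_perm_pairs)
      show "c \<in> perm_pairs n" using c by simp
      then show "?y \<in> {1..n}" using trajectory_in_range[OF _ x] y(2) by blast
      show "z \<in> {1..n}" using z by (simp add: fresh_def)
    qed
    moreover have "switch l ?t (f (c, z)) = c"
      unfolding f_def prod.case by (rule switch_switch[OF transpose_comp_involutory])
    ultimately show ?thesis using trajectory by blast
  qed
  have "inj_on f (Sigma ?A fresh)"
  proof (rule inj_onI)
    fix u v assume uv: "u \<in> Sigma ?A fresh" "v \<in> Sigma ?A fresh" "f u = f v"
    obtain c z c' z' where [simp]: "u = (c, z)" "v = (c', z')"
      by (cases u, cases v)
    have A: "c \<in> ?A" "z \<in> fresh c" "c' \<in> ?A" "z' \<in> fresh c'" and eq: "f (c, z) = f (c', z')"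
      using uv by simp_all
    note S = step[OF A(1,2)] and S' = step[OF A(3,4), folded eq]
    have z: "z' = z" and p: "trajectory c' w x = trajectory c w x"
      using S S' by (simp_all only:)
    have "c = switch l (Transposition.transpose (trajectory c w x ! i) z) (f (c, z))"
      using S by (simp only:)
    also have "\<dots> = c'"
      using S' unfolding z p by (simp only:)
    finally show "u = v"
      using z by simp
  qed
  moreover have "f ` Sigma ?A fresh \<subseteq> perm_pairs n"
    using step by auto
  ultimately have "card (Sigma ?A fresh) \<le> card (perm_pairs n)"
    using card_inj_on_le finite_perm_pairs by blast
  moreover have "card (Sigma ?A fresh) = card ?A * (n - Suc (length w))"
  proof -
    have "card (Sigma ?A fresh) = (\<Sum>c\<in>?A. card (fresh c))"
      by (rule card_SigmaI[OF fin]) (simp add: fresh_def)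
    also have "\<dots> = (\<Sum>c\<in>?A. n - Suc (length w))"
      by (rule sum.cong[OF refl card_fresh])
    finally show ?thesis by simp
  qed
  ultimately show ?thesis by simp
qed

lemma card_trajectory_not_distinct:
  assumes "reduced w" "x \<in> {1..n}"
  shows "card {c \<in> perm_pairs n. \<not> distinct (trajectory c w x)} * (n - length w)
      \<le> (length w)\<^sup>2 * card (perm_pairs n)"
  using assms
proof (induction w)
  case Nil
  then show ?case by simp
next
  case (Cons l w)
  let ?N = "card (perm_pairs n)" and ?L = "length w"
  let ?B = "{c \<in> perm_pairs n. \<not> distinct (trajectory c w x)}"
  let ?A = "\<lambda>i. {c \<in> perm_pairs n. distinct (trajectory c w x) \<and>
              word_act c (l # w) x = trajectory c w x ! i \<and> i \<le> length w}"
  have "{c \<in> perm_pairs n. \<not> distinct (trajectory c (l # w) x)} \<subseteq> ?B \<union> (\<Union>i\<in>{..?L}. ?A i)"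
  proof
    fix c assume c: "c \<in> {c \<in> perm_pairs n. \<not> distinct (trajectory c (l # w) x)}"
    show "c \<in> ?B \<union> (\<Union>i\<in>{..?L}. ?A i)"
    proof (cases "distinct (trajectory c w x)")
      case True
      then have "word_act c (l # w) x \<in> set (trajectory c w x)"
        using c by simp
      then obtain i where "i < length (trajectory c w x)" "trajectory c w x ! i = word_act c (l # w) x"
        unfolding in_set_conv_nth by blast
      then have "i \<in> {..?L}" "c \<in> ?A i"
        using c True by simp_all
      then show ?thesis by blast
    qed (use c in simp)
  qed
  then have "card {c \<in> perm_pairs n. \<not> distinct (trajectory c (l # w) x)} \<le> card (?B \<union> (\<Union>i\<in>{..?L}. ?A i))"
    by (rule card_mono[rotated]) (use finite_perm_pairs[of n] in auto)
  also have "\<dots> \<le> card ?B + card (\<Union>i\<in>{..?L}. ?A i)"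
    by (rule card_Un_le)
  also have "card (\<Union>i\<in>{..?L}. ?A i) \<le> (\<Sum>i\<in>{..?L}. card (?A i))"
    by (rule card_UN_le) simp
  finally have "card {c \<in> perm_pairs n. \<not> distinct (trajectory c (l # w) x)} * (n - Suc ?L)
      \<le> (card ?B + (\<Sum>i\<in>{..?L}. card (?A i))) * (n - Suc ?L)"
    by simp
  also have "\<dots> = card ?B * (n - Suc ?L) + (\<Sum>i\<in>{..?L}. card (?A i) * (n - Suc ?L))"
    by (simp only: add_mult_distrib sum_distrib_right)
  also have "\<dots> \<le> card ?B * (n - ?L) + (\<Sum>i\<in>{..?L}. ?N)"
    by (intro add_mono sum_mono card_first_return Cons.prems mult_left_mono) simp_all
  also have "\<dots> \<le> ?L\<^sup>2 * ?N + Suc ?L * ?N"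
    using Cons.IH[OF reduced_ConsD[OF Cons.prems(1)] Cons.prems(2)] by simp
  also have "\<dots> \<le> (Suc ?L)\<^sup>2 * ?N"
    unfolding add_mult_distrib[symmetric] by (rule mult_right_mono) (simp_all add: power2_eq_square)
  finally show ?case by simp
qed

text \<open>Markov's inequality, with the number of fixed points averaged over all pairs.\<close>

lemma card_fixed_points_large:
  assumes w: "reduced w" "w \<noteq> []"
  shows "card {c \<in> perm_pairs n. n \<le> r * card {x \<in> {1..n}. word_act c w x = x}} * (n - length w)
      \<le> r * (length w)\<^sup>2 * card (perm_pairs n)" (is "card ?B * _ \<le> _")
proof (cases "n = 0")
  case False
  let ?N = "card (perm_pairs n)" and ?L = "length w"
  have fin: "finite (perm_pairs n)" "finite ?B" using finite_perm_pairs[of n] by auto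
  have "n * card ?B = (\<Sum>c\<in>?B. n)" by simp
  also have "\<dots> \<le> (\<Sum>c\<in>?B. r * card {x \<in> {1..n}. word_act c w x = x})"
    by (rule sum_mono) simp
  also have "\<dots> \<le> (\<Sum>c\<in>perm_pairs n. r * card {x \<in> {1..n}. word_act c w x = x})"
    by (rule sum_mono2[OF fin(1)]) auto
  also have "\<dots> = r * (\<Sum>c\<in>perm_pairs n. card {x \<in> {1..n}. word_act c w x = x})"
    by (simp only: sum_distrib_left)
  also have "(\<Sum>c\<in>perm_pairs n. card {x \<in> {1..n}. word_act c w x = x})
      = (\<Sum>x\<in>{1..n}. card {c \<in> perm_pairs n. word_act c w x = x})"
    using sum.swap_restrict[OF fin(1), of "{1..n}" "\<lambda>_ _. 1::nat" "\<lambda>c x. word_act c w x = x"] by simp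
  finally have "n * card ?B * (n - ?L) \<le> r * (\<Sum>x\<in>{1..n}. card {c \<in> perm_pairs n. word_act c w x = x}) * (n - ?L)"
    by (rule mult_right_mono) simp
  also have "\<dots> = r * (\<Sum>x\<in>{1..n}. card {c \<in> perm_pairs n. word_act c w x = x} * (n - ?L))"
    by (simp only: sum_distrib_right mult.assoc)
  also have "\<dots> \<le> r * (\<Sum>x\<in>{1..n}. ?L\<^sup>2 * ?N)"
  proof (intro mult_left_mono sum_mono)
    fix x assume x: "x \<in> {1..n}"
    have "{c \<in> perm_pairs n. word_act c w x = x} \<subseteq> {c \<in> perm_pairs n. \<not> distinct (trajectory c w x)}"
      using w(2) by (cases w) (auto simp del: word_act_Cons simp: start_in_trajectory)
    then have "card {c \<in> perm_pairs n. word_act c w x = x} \<le> card {c \<in> perm_pairs n. \<not> distinct (trajectory c w x)}"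
      by (rule card_mono[rotated]) (use fin in auto)
    then show "card {c \<in> perm_pairs n. word_act c w x = x} * (n - ?L) \<le> ?L\<^sup>2 * ?N"
      using card_trajectory_not_distinct[OF w(1) x] mult_right_mono le_trans by blast
  qed simp
  also have "\<dots> = n * (r * ?L\<^sup>2 * ?N)" by simp
  finally have "n * (card ?B * (n - ?L)) \<le> n * (r * ?L\<^sup>2 * ?N)"
    by (simp only: mult.assoc)
  then show ?thesis using False by simp
qed simp


section \<open>Permutations almost commuting with a fixed permutation\<close>

text \<open>Records of a map on a small set: the value \<open>0\<close>, which no permutation of \<open>{1..n}\<close> takes
  there, means that nothing is recorded.  Restricting to extensional maps makes the set finite.\<close>

definition sparse_maps :: "nat \<Rightarrow> nat \<Rightarrow> (nat \<Rightarrow> nat) set" where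
  "sparse_maps n d = {g \<in> {1..n} \<rightarrow>\<^sub>E {0..n}. card {i \<in> {1..n}. g i \<noteq> 0} \<le> d}"

definition difference_code :: "nat \<Rightarrow> (nat \<Rightarrow> nat) \<Rightarrow> (nat \<Rightarrow> nat) \<Rightarrow> nat \<Rightarrow> nat" where
  "difference_code n p q = (\<lambda>i\<in>{1..n}. if p i = q i then 0 else p i)"

definition almost_centralizer :: "nat \<Rightarrow> nat \<Rightarrow> (nat \<Rightarrow> nat) \<Rightarrow> (nat \<Rightarrow> nat) set" where
  "almost_centralizer n d p =
     {a. a permutes {1..n} \<and> card {i \<in> {1..n}. a (p i) \<noteq> p (a i)} \<le> d}"

text \<open>Permutations whose cycles are intervals, each traversed upwards: the bound
  \<open>q i \<le> Suc i\<close> leaves a choice only between stepping up and closing the current cycle.\<close>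

definition canonical_perms :: "nat \<Rightarrow> (nat \<Rightarrow> nat) set" where
  "canonical_perms n = {q. q permutes {1..n} \<and> (\<forall>i\<in>{1..n}. q i \<le> Suc i)}"

lemma finite_sparse_maps: "finite (sparse_maps n d)"
  unfolding sparse_maps_def by (rule finite_Collect_conjI) (auto intro: finite_PiE)

text \<open>A sparse map is determined by its support, one of \<open>2 ^ n\<close> sets, and its values there.\<close>

lemma card_sparse_maps: "card (sparse_maps n d) \<le> 2 ^ n * Suc n ^ d"
proof -
  let ?D = "{D \<in> Pow {1..n}. card D \<le> d}"
  let ?S = "Sigma ?D (\<lambda>D. D \<rightarrow>\<^sub>E {0..n})"
  let ?supp = "\<lambda>g::nat \<Rightarrow> nat. {i \<in> {1..n}. g i \<noteq> 0}"
  let ?f = "\<lambda>g. (?supp g, restrict g (?supp g))"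
  have fin: "finite D" if "D \<in> ?D" for D
    using that by (intro finite_subset[of D "{1..n}"]) simp_all
  have "inj_on ?f (sparse_maps n d)"
  proof (rule inj_onI)
    fix g h assume gh: "g \<in> sparse_maps n d" "h \<in> sparse_maps n d" "?f g = ?f h"
    have "g i = h i" for i
    proof (cases "i \<in> {1..n}")
      case True
      have "?supp g = ?supp h" "restrict g (?supp g) = restrict h (?supp h)"
        using gh(3) unfolding prod.inject by blast+
      then have "i \<in> ?supp g \<longleftrightarrow> i \<in> ?supp h" "restrict g (?supp g) i = restrict h (?supp h) i"
        by (simp only:)+
      with True show ?thesis
        by (cases "g i = 0"; cases "h i = 0") (auto simp: restrict_def)
    next
      case False
      with gh(1,2) show ?thesis
        by (auto simp: sparse_maps_def PiE_def extensional_def)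
    qed
    then show "g = h" by blast
  qed
  moreover have "?f ` sparse_maps n d \<subseteq> ?S"
    by (auto simp: sparse_maps_def PiE_def Pi_def)
  moreover have "finite ?S"
    using fin by (intro finite_SigmaI finite_PiE) auto
  ultimately have "card (sparse_maps n d) \<le> card ?S"
    by (rule card_inj_on_le)
  also have "\<dots> = (\<Sum>D\<in>?D. card (D \<rightarrow>\<^sub>E {0..n}))"
    using fin by (intro card_SigmaI) (auto intro!: finite_PiE)
  also have "\<dots> \<le> (\<Sum>D\<in>?D. Suc n ^ d)"
  proof (rule sum_mono)
    fix D assume D: "D \<in> ?D"
    then have "card (D \<rightarrow>\<^sub>E {0..n}) = Suc n ^ card D"
      using fin[OF D] by (simp add: card_PiE)
    also have "\<dots> \<le> Suc n ^ d"
      using D by (intro power_increasing) auto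
    finally show "card (D \<rightarrow>\<^sub>E {0..n}) \<le> Suc n ^ d" .
  qed
  also have "\<dots> = card ?D * Suc n ^ d" by simp
  also have "card ?D \<le> card (Pow {1..n})"
    by (rule card_mono) auto
  then have "card ?D * Suc n ^ d \<le> 2 ^ n * Suc n ^ d"
    by (simp add: card_Pow)
  finally show ?thesis .
qed

lemma difference_code_sparse:
  assumes "p permutes {1..n}" "card {i \<in> {1..n}. p i \<noteq> q i} \<le> d"
  shows "difference_code n p q \<in> sparse_maps n d"
proof -
  have pos: "p i \<in> {1..n}" if "i \<in> {1..n}" for i
    using permutes_in_image[OF assms(1)] that by blast
  then have "{i \<in> {1..n}. difference_code n p q i \<noteq> 0} = {i \<in> {1..n}. p i \<noteq> q i}"
    by (fastforce simp: difference_code_def)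
  then show ?thesis
    using assms(2) pos by (auto simp: sparse_maps_def difference_code_def)
qed

lemma difference_code_inject:
  assumes "p permutes {1..n}" "p' permutes {1..n}"
    and "difference_code n p q = difference_code n p' q"
  shows "p = p'"
proof
  fix i show "p i = p' i"
  proof (cases "i \<in> {1..n}")
    case True
    then have "(if p i = q i then 0 else p i) = (if p' i = q i then 0 else p' i)"
      using fun_cong[OF assms(3), of i] by (simp add: difference_code_def)
    moreover have "p i \<in> {1..n}" "p' i \<in> {1..n}"
      using permutes_in_image[OF assms(1)] permutes_in_image[OF assms(2)] True by blast+
    ultimately show ?thesis by (auto split: if_splits)
  next
    case False
    then show ?thesis using assms(1,2) by (simp add: permutes_not_in)
  qed
qed

lemma card_differences_right:
  fixes p q :: "nat \<Rightarrow> nat"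
  assumes "s permutes {1..n}"
  shows "card {i \<in> {1..n}. p (s i) \<noteq> q (s i)} = card {i \<in> {1..n}. p i \<noteq> q i}"
proof (cases "n = 0")
  case False
  then show ?thesis
    using hamming_dist_right[OF assms, of p q] by (simp add: hamming_dist_def)
qed simp

text \<open>Follow \<open>p\<close> as long as it leads to a point not yet listed, and otherwise continue with an
  arbitrary unlisted point.\<close>

lemma traversal_exists:
  assumes p: "p permutes {1..n}" and "k \<le> n"
  shows "\<exists>xs. distinct xs \<and> set xs \<subseteq> {1..n} \<and> length xs = k \<and>
           (\<forall>i. Suc i < k \<longrightarrow> p (xs ! i) \<in> set (take (i + 2) xs))"
  using \<open>k \<le> n\<close>
proof (induction k)
  case (Suc k)
  then obtain xs where xs: "distinct xs" "set xs \<subseteq> {1..n}" "length xs = k"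
    and next_xs: "\<And>i. Suc i < k \<Longrightarrow> p (xs ! i) \<in> set (take (i + 2) xs)"
    by auto
  have "card (set xs) < card {1..n}"
    using xs Suc.prems by (simp add: distinct_card)
  then have "\<not> {1..n} \<subseteq> set xs"
    using card_mono[of "set xs" "{1..n}"] by auto
  then obtain z where z: "z \<in> {1..n}" "z \<notin> set xs" by blast
  define y where "y = (if xs \<noteq> [] \<and> p (last xs) \<notin> set xs then p (last xs) else z)"
  have "p (last xs) \<in> {1..n}" if "xs \<noteq> []"
    using permutes_in_image[OF p] last_in_set[OF that] xs(2) by blast
  then have y: "y \<in> {1..n}" "y \<notin> set xs"
    using z by (auto simp: y_def)
  have "p ((xs @ [y]) ! i) \<in> set (take (i + 2) (xs @ [y]))" if i: "Suc i < Suc k" for i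
  proof (cases "Suc i = k")
    case True
    then have "xs \<noteq> []" using xs(3) by auto
    then have "(xs @ [y]) ! i = last xs"
      using True xs(3) by (auto simp: nth_append last_conv_nth)
    then show ?thesis
      using True xs(3) \<open>xs \<noteq> []\<close> by (simp add: y_def)
  next
    case False
    then show ?thesis
      using i next_xs[of i] xs(3) by (simp add: nth_append)
  qed
  then show ?case
    using xs y by (intro exI[of _ "xs @ [y]"]) auto
qed simp

text \<open>Numbering the points in the order of a complete traversal turns \<open>p\<close> into
  canonical form.\<close>

lemma conjugate_canonical:
  assumes p: "p permutes {1..n}"
  shows "\<exists>f. f permutes {1..n} \<and> f \<circ> p \<circ> inv_into UNIV f \<in> canonical_perms n"
proof -
  obtain xs where xs: "distinct xs" "set xs \<subseteq> {1..n}" "length xs = n"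
    and next_xs: "\<And>i. Suc i < n \<Longrightarrow> p (xs ! i) \<in> set (take (i + 2) xs)"
    using traversal_exists[OF p, of n] by auto
  define e where "e i = (if i \<in> {1..n} then xs ! (i - 1) else i)" for i
  have "inj_on e {1..n}"
    using xs by (auto simp: inj_on_def e_def nth_eq_iff_index_eq)
  moreover have "e ` {1..n} \<subseteq> {1..n}"
  proof
    fix j assume "j \<in> e ` {1..n}"
    then obtain i where "i \<in> {1..n}" "j = xs ! (i - 1)" by (auto simp: e_def)
    moreover from this have "xs ! (i - 1) \<in> set xs" using xs(3) by (intro nth_mem) auto
    ultimately show "j \<in> {1..n}" using xs(2) by auto
  qed
  ultimately have "bij_betw e {1..n} {1..n}"
    unfolding bij_betw_def by (intro conjI endo_inj_surj) simp_all
  then have e: "e permutes {1..n}"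
    by (rule bij_imp_permutes) (auto simp: e_def)
  let ?f = "inv_into UNIV e"
  have f: "?f permutes {1..n}" by (rule permutes_inv[OF e])
  have ff: "inv_into UNIV ?f = e" by (rule permutes_inv_inv[OF e])
  have perm: "?f \<circ> p \<circ> e permutes {1..n}"
    by (intro permutes_compose e f p)
  have "(?f \<circ> p \<circ> e) i \<le> Suc i" if i: "i \<in> {1..n}" for i
  proof (cases "i = n")
    case True
    have "(?f \<circ> p \<circ> e) i \<in> {1..n}"
      using permutes_in_image[OF perm] i by blast
    then show ?thesis using True by simp
  next
    case False
    then have "p (xs ! (i - 1)) \<in> set (take (Suc i) xs)"
      using next_xs[of "i - 1"] i by simp
    then obtain j where j: "j < Suc i" "j < n" "p (xs ! (i - 1)) = xs ! j"
      using xs(3) by (auto simp: in_set_conv_nth)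
    then have "p (e i) = e (Suc j)"
      using i by (simp add: e_def)
    then have "(?f \<circ> p \<circ> e) i = Suc j"
      using permutes_inverses(2)[OF e] by simp
    then show ?thesis using j by simp
  qed
  then show ?thesis
    using f perm ff by (intro exI[of _ ?f]) (auto simp: canonical_perms_def)
qed

text \<open>The set of points where \<open>q\<close> steps up determines \<open>q\<close>: at any other point \<open>i\<close>
  the value lies in \<open>{1..i}\<close>, and the values at the points below \<open>i\<close> occupy all but
  one element of that interval.\<close>

lemma card_canonical_perms: "card (canonical_perms n) \<le> 2 ^ n"
proof -
  let ?step = "\<lambda>q. {i \<in> {1..n}. q i = Suc i}"
  have "inj_on ?step (canonical_perms n)"
  proof (rule inj_onI)
    fix q q' assume qq: "q \<in> canonical_perms n" "q' \<in> canonical_perms n" "?step q = ?step q'"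
    have perm: "q permutes {1..n}" "q' permutes {1..n}"
      using qq by (auto simp: canonical_perms_def)
    have "q i = q' i" if "i \<in> {1..n}" for i
      using that
    proof (induction i rule: less_induct)
      case (less i)
      show ?case
      proof (cases "i \<in> ?step q")
        case True
        moreover have "i \<in> ?step q'" using True qq(3) by blast
        ultimately show ?thesis by simp
      next
        case False
        then have no: "i \<notin> ?step q" "i \<notin> ?step q'" using qq(3) by blast+
        let ?I = "q ` {1..<i}"
        have eq: "q' ` {1..<i} = ?I"
          using less by (intro image_cong) auto
        have le: "q j \<in> {1..n} \<and> q j \<le> Suc j" "q' j \<in> {1..n} \<and> q' j \<le> Suc j" if "j \<in> {1..n}" for j
          using qq(1,2) that permutes_in_image[OF perm(1)] permutes_in_image[OF perm(2)]
          by (auto simp: canonical_perms_def)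
        have sub: "?I \<subseteq> {1..i}"
        proof
          fix y assume "y \<in> ?I"
          then obtain j where "j \<in> {1..<i}" "y = q j" by blast
          then show "y \<in> {1..i}" using le(1)[of j] less.prems by auto
        qed
        have "card ?I = i - 1"
          using permutes_inj_on[OF perm(1)] by (simp add: card_image)
        then have "card ({1..i} - ?I) = 1"
          using sub less.prems by (simp add: card_Diff_subset finite_subset)
        then obtain z where z: "{1..i} - ?I = {z}"
          by (auto simp: card_1_singleton_iff)
        have "q i \<notin> ?I"
          using permutes_inj[OF perm(1)] by (simp add: inj_image_mem_iff)
        moreover have "q' i \<notin> ?I"
          unfolding eq[symmetric] using permutes_inj[OF perm(2)] by (simp add: inj_image_mem_iff)
        moreover have "q i \<in> {1..i}" "q' i \<in> {1..i}"
          using no le[OF less.prems] less.prems by auto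
        ultimately have "q i \<in> {z}" "q' i \<in> {z}"
          unfolding z[symmetric] by blast+
        then show ?thesis by simp
      qed
    qed
    then show "q = q'"
      using permutes_not_in[OF perm(1)] permutes_not_in[OF perm(2)] by fastforce
  qed
  moreover have "?step ` canonical_perms n \<subseteq> Pow {1..n}" by auto
  ultimately have "card (canonical_perms n) \<le> card (Pow {1..n})"
    by (rule card_inj_on_le) simp
  then show ?thesis by (simp add: card_Pow)
qed

lemma finite_canonical_perms: "finite (canonical_perms n)"
  by (rule finite_subset[of _ "{q. q permutes {1..n}}"])
     (auto simp: canonical_perms_def intro: finite_permutations)

lemma finite_almost_centralizer: "finite (almost_centralizer n d p)"
  by (rule finite_subset[of _ "{q. q permutes {1..n}}"])
     (auto simp: almost_centralizer_def intro: finite_permutations)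

text \<open>For exact commutation this says that there are at most \<open>2 ^ n * n!\<close> commuting pairs, since every
  conjugacy class meets the canonical permutations.  The encoding below gives this without any orbit counting
  and tolerates errors.  Let \<open>F p\<close> conjugate \<open>p\<close> to the canonical \<open>q p\<close>.  If \<open>a\<close> commutes
  with \<open>p\<close>, then \<open>g = F p \<circ> a\<close> conjugates \<open>p\<close> to \<open>q p\<close> as well, so that \<open>(q p, g)\<close>
  determines \<open>p\<close>, hence \<open>F p\<close>, hence \<open>a\<close>.  If \<open>a\<close> commutes with \<open>p\<close> up to \<open>d\<close> points, the
  conjugate \<open>r\<close> of \<open>p\<close> by \<open>g\<close> differs from \<open>q p\<close> in at most \<open>d\<close> points, and a sparse map
  records the difference.\<close>

lemma sum_card_almost_centralizer:
  "(\<Sum>p | p permutes {1..n}. card (almost_centralizer n d p))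
     \<le> 2 ^ n * card (sparse_maps n d) * fact n"
proof -
  let ?S = "{p. p permutes {1..n}}"
  have "\<exists>F. \<forall>p\<in>?S. F p permutes {1..n} \<and> F p \<circ> p \<circ> inv_into UNIV (F p) \<in> canonical_perms n"
    by (intro bchoice ballI conjugate_canonical) simp
  then obtain F where F: "\<And>p. p permutes {1..n} \<Longrightarrow> F p permutes {1..n}"
    and can: "\<And>p. p permutes {1..n} \<Longrightarrow> F p \<circ> p \<circ> inv_into UNIV (F p) \<in> canonical_perms n"
    by blast
  define q where "q p = F p \<circ> p \<circ> inv_into UNIV (F p)" for p
  define g where "g p a = F p \<circ> a" for p and a :: "nat \<Rightarrow> nat"
  define r where "r p a = g p a \<circ> p \<circ> inv_into UNIV (g p a)" for p a
  define code where "code = (\<lambda>(p, a). (q p, difference_code n (r p a) (q p), g p a))"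
  let ?A = "Sigma ?S (almost_centralizer n d)"
  let ?T = "canonical_perms n \<times> sparse_maps n d \<times> ?S"
  have perms: "g p a permutes {1..n}" "r p a permutes {1..n}"
    if "p permutes {1..n}" "a permutes {1..n}" for p a
    using that F[OF that(1)] unfolding r_def g_def
    by (auto intro!: permutes_compose permutes_inv)
  have "inj_on code ?A"
  proof (rule inj_onI)
    fix u v assume uv: "u \<in> ?A" "v \<in> ?A" "code u = code v"
    obtain p a p' a' where [simp]: "u = (p, a)" and [simp]: "v = (p', a')" by (cases u, cases v)
    have per: "p permutes {1..n}" "a permutes {1..n}" "p' permutes {1..n}" "a' permutes {1..n}"
      using uv by (auto simp: almost_centralizer_def)
    have eq: "q p = q p'" "difference_code n (r p a) (q p) = difference_code n (r p' a') (q p')"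
      "g p a = g p' a'"
      using uv(3) unfolding code_def by auto
    have req: "r p a = r p' a'"
      using difference_code_inject[OF perms(2)[OF per(1,2)] perms(2)[OF per(3,4)]] eq by simp
    have recover: "p x = inv_into UNIV (g p a) (r p a (g p a x))"
      "a x = inv_into UNIV (F p) (g p a x)" if "p permutes {1..n}" "a permutes {1..n}" for p a x
      using permutes_inverses(2)[OF perms(1)[OF that]] permutes_inverses(2)[OF F[OF that(1)]]
      by (simp_all add: r_def g_def)
    have "p = p'"
      using recover(1)[OF per(1,2)] recover(1)[OF per(3,4)] req eq(3) by auto
    moreover from this have "a = a'"
      using recover(2)[OF per(1,2)] recover(2)[OF per(3,4)] eq(3) by auto
    ultimately show "u = v" by simp
  qed
  moreover have "code ` ?A \<subseteq> ?T"
  proof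
    fix t assume "t \<in> code ` ?A"
    then obtain p a where pa: "p permutes {1..n}" "a \<in> almost_centralizer n d p" and t: "t = code (p, a)"
      by auto
    have a: "a permutes {1..n}" and few: "card {i \<in> {1..n}. a (p i) \<noteq> p (a i)} \<le> d"
      using pa by (auto simp: almost_centralizer_def)
    have "card {i \<in> {1..n}. r p a i \<noteq> q p i} = card {i \<in> {1..n}. r p a (g p a i) \<noteq> q p (g p a i)}"
      by (rule card_differences_right[OF perms(1)[OF pa(1) a], symmetric])
    also have "{i \<in> {1..n}. r p a (g p a i) \<noteq> q p (g p a i)} = {i \<in> {1..n}. a (p i) \<noteq> p (a i)}"
    proof -
      have "r p a (g p a i) = F p (a (p i))" "q p (g p a i) = F p (p (a i))" for i
        using permutes_inverses(2)[OF perms(1)[OF pa(1) a]] permutes_inverses(2)[OF F[OF pa(1)]]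
        by (simp_all add: r_def q_def g_def)
      then show ?thesis
        using permutes_inj[OF F[OF pa(1)]] by (simp add: inj_eq)
    qed
    finally have "difference_code n (r p a) (q p) \<in> sparse_maps n d"
      using few by (intro difference_code_sparse perms(2)[OF pa(1) a]) simp
    then show "t \<in> ?T"
      using t perms(1)[OF pa(1) a] can[OF pa(1)] by (simp add: code_def q_def)
  qed
  moreover have finT: "finite ?T"
    by (intro finite_cartesian_product finite_canonical_perms finite_sparse_maps finite_permutations) simp
  ultimately have "card ?A \<le> card ?T" by (rule card_inj_on_le)
  also have "card ?T = card (canonical_perms n) * (card (sparse_maps n d) * fact n)"
    by (simp only: card_cartesian_product card_perms)
  also have "\<dots> \<le> 2 ^ n * (card (sparse_maps n d) * fact n)"
    by (rule mult_right_mono[OF card_canonical_perms]) simp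
  finally show ?thesis
    by (simp add: card_SigmaI finite_permutations finite_almost_centralizer mult.assoc)
qed

text \<open>A maximal set disjoint from its image under \<open>p\<close> works: a moved point outside
  \<open>X\<close>, \<open>p ` X\<close> and the preimage of \<open>X\<close> could be added to it.\<close>

lemma independent_set_in_support:
  fixes p :: "nat \<Rightarrow> nat"
  assumes p: "p permutes {1..n}"
  shows "\<exists>X\<subseteq>{1..n}. X \<inter> p ` X = {} \<and> card {i \<in> {1..n}. p i \<noteq> i} \<le> 3 * card X"
proof -
  let ?F = "{X \<in> Pow {1..n}. X \<inter> p ` X = {}}"
  have "finite ?F"
    by (rule finite_subset[of _ "Pow {1..n}"]) (blast, simp)
  moreover have "?F \<noteq> {}" by auto
  ultimately have "\<exists>X\<in>?F. \<forall>Y\<in>?F. X \<le> Y \<longrightarrow> X = Y"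
    by (rule finite_has_maximal)
  then obtain X where X: "X \<in> ?F" and max: "\<forall>Y\<in>?F. X \<subseteq> Y \<longrightarrow> X = Y"
    by (rule bexE)
  have finX: "finite X" using X by (intro finite_subset[of X "{1..n}"]) simp_all
  have inj: "inj p" using p by (rule permutes_inj)
  let ?p' = "inv_into UNIV p"
  have "{i \<in> {1..n}. p i \<noteq> i} \<subseteq> X \<union> p ` X \<union> ?p' ` X"
  proof
    fix y assume y: "y \<in> {i \<in> {1..n}. p i \<noteq> i}"
    show "y \<in> X \<union> p ` X \<union> ?p' ` X"
    proof (rule ccontr)
      assume no: "y \<notin> X \<union> p ` X \<union> ?p' ` X"
      have "p y \<notin> X"
      proof
        assume "p y \<in> X"
        then have "?p' (p y) \<in> ?p' ` X" by (rule imageI)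
        then show False using no inj by simp
      qed
      then have "insert y X \<in> ?F"
        using X y no by auto
      from max[rule_format, OF this] show False using no by blast
    qed
  qed
  then have "card {i \<in> {1..n}. p i \<noteq> i} \<le> card (X \<union> p ` X \<union> ?p' ` X)"
    by (rule card_mono[rotated]) (use finX in simp)
  also have "\<dots> \<le> card X + card (p ` X) + card (?p' ` X)"
    by (meson card_Un_le add_le_mono le_refl le_trans)
  also have "\<dots> \<le> 3 * card X"
    using card_image_le[OF finX, of p] card_image_le[OF finX, of ?p'] by simp
  finally show ?thesis using X by blast
qed

text \<open>Where \<open>a\<close> commutes with \<open>p\<close>, the value of \<open>a\<close> at \<open>p x\<close> is determined by
  its value at \<open>x\<close>.  With \<open>X\<close> independent as above, \<open>a\<close> is therefore determined by its values off
  \<open>p ` X\<close>, apart from at most \<open>d\<close> recorded exceptions.  Composing \<open>a\<close> with an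
  arbitrary permutation of \<open>p ` X\<close> keeps exactly those values, which gains the factor \<open>(card X)!\<close>.\<close>

lemma card_almost_centralizer:
  assumes p: "p permutes {1..n}" and m: "3 * m \<le> card {i \<in> {1..n}. p i \<noteq> i}"
  shows "card (almost_centralizer n d p) * fact m \<le> card (sparse_maps n d) * fact n"
proof -
  obtain X where X: "X \<subseteq> {1..n}" "X \<inter> p ` X = {}" "card {i \<in> {1..n}. p i \<noteq> i} \<le> 3 * card X"
    using independent_set_in_support[OF p] by blast
  let ?p' = "inv_into UNIV p"
  let ?S = "{a. a permutes {1..n}}" and ?Y = "p ` X"
  let ?P = "{s. s permutes ?Y}"
  have finX: "finite X" using X(1) by (intro finite_subset[of X "{1..n}"]) simp_all
  have YN: "?Y \<subseteq> {1..n}"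
    using X(1) permutes_in_image[OF p] by blast
  have sperm: "s permutes {1..n}" if "s \<in> ?P" for s
    using that YN by (auto intro: permutes_subset)
  define code where "code = (\<lambda>(a, s). (difference_code n a (p \<circ> a \<circ> ?p'), a \<circ> s :: nat \<Rightarrow> nat))"
  let ?A = "almost_centralizer n d p \<times> ?P"
  have "inj_on code ?A"
  proof (rule inj_onI)
    fix u v assume uv: "u \<in> ?A" "v \<in> ?A" "code u = code v"
    obtain a s a' s' where [simp]: "u = (a, s)" "v = (a', s')" by (cases u, cases v)
    have a: "a permutes {1..n}" "a' permutes {1..n}" and s: "s permutes ?Y" "s' permutes ?Y"
      using uv by (auto simp: almost_centralizer_def)
    have code_eq: "difference_code n a (p \<circ> a \<circ> ?p') = difference_code n a' (p \<circ> a' \<circ> ?p')"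
      and comp_eq: "a \<circ> s = a' \<circ> s'"
      using uv(3) by (simp_all add: code_def)
    have off: "a x = a' x" if "x \<notin> ?Y" for x
      using fun_cong[OF comp_eq, of x] permutes_not_in[OF s(1) that] permutes_not_in[OF s(2) that]
      by simp
    have "a y = a' y" for y
    proof (cases "y \<in> ?Y")
      case True
      then obtain x where x: "x \<in> X" "y = p x" by blast
      have "x \<notin> ?Y" using x(1) X(2) by blast
      then have ax: "a x = a' x" by (rule off)
      have yN: "y \<in> {1..n}" using True YN by blast
      have "inv_into UNIV p y = x" using x(2) permutes_inverses(2)[OF p] by simp
      then have "(if a y = p (a x) then 0 else a y) = (if a' y = p (a' x) then 0 else a' y)"
        using fun_cong[OF code_eq, of y] yN by (simp add: difference_code_def split del: if_split)
      moreover have "a y \<in> {1..n}" "a' y \<in> {1..n}"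
        using yN permutes_in_image[OF a(1)] permutes_in_image[OF a(2)] by blast+
      ultimately show ?thesis using ax by (auto split: if_splits)
    qed (rule off)
    then have "a = a'" by blast
    moreover from this have "s = s'"
      using comp_eq permutes_inj[OF a(2)] by (simp add: fun_eq_iff inj_eq)
    ultimately show "u = v" by simp
  qed
  moreover have "code ` ?A \<subseteq> sparse_maps n d \<times> ?S"
  proof
    fix t assume "t \<in> code ` ?A"
    then obtain a s where as: "a \<in> almost_centralizer n d p" "s \<in> ?P" and t: "t = code (a, s)"
      by auto
    have a: "a permutes {1..n}" and few: "card {i \<in> {1..n}. a (p i) \<noteq> p (a i)} \<le> d"
      using as by (auto simp: almost_centralizer_def)
    have "card {i \<in> {1..n}. a i \<noteq> (p \<circ> a \<circ> ?p') i} = card {i \<in> {1..n}. a (p i) \<noteq> (p \<circ> a \<circ> ?p') (p i)}"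
      by (rule card_differences_right[OF p, symmetric])
    also have "\<dots> \<le> d"
      using few permutes_inverses(2)[OF p] by simp
    finally have "difference_code n a (p \<circ> a \<circ> ?p') \<in> sparse_maps n d"
      by (rule difference_code_sparse[OF a])
    then show "t \<in> sparse_maps n d \<times> ?S"
      using t permutes_compose[OF sperm[OF as(2)] a] by (simp add: code_def)
  qed
  moreover have "finite (sparse_maps n d \<times> ?S)"
    by (intro finite_cartesian_product finite_sparse_maps finite_permutations) simp
  ultimately have "card ?A \<le> card (sparse_maps n d \<times> ?S)" by (rule card_inj_on_le)
  moreover have "card ?P = fact (card X)"
    using card_image[OF permutes_inj_on[OF p], of X] finX by (intro card_permutations) simp_all
  ultimately have "card (almost_centralizer n d p) * fact (card X) \<le> card (sparse_maps n d) * fact n"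
    by (simp only: card_cartesian_product card_perms)
  moreover have "fact m \<le> (fact (card X) :: nat)"
    using m X(3) by (intro fact_mono) linarith
  ultimately show ?thesis
    using mult_left_mono le_trans zero_le by metis
qed

section \<open>Most pairs are rigid\<close>

definition rigid :: "nat \<Rightarrow> nat \<Rightarrow> nat \<Rightarrow> (bool \<Rightarrow> nat \<Rightarrow> nat) \<Rightarrow> bool" where
  "rigid n d m c \<longleftrightarrow> (\<forall>p. p permutes {1..n} \<longrightarrow>
     (\<forall>s. card {i \<in> {1..n}. c s (p i) \<noteq> p (c s i)} \<le> d) \<longrightarrow> card {i \<in> {1..n}. p i \<noteq> i} < m)"

text \<open>Let \<open>A p\<close> be the number of permutations almost commuting with \<open>p\<close>.  A union bound over
  all \<open>p\<close> moving at least \<open>3 * m\<close> points leaves the sum of the \<open>(A p)\<^sup>2\<close>.  Bounding every term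
  by the largest one would be too lossy, since there may be about \<open>n!\<close> of them; instead, the sum is
  bounded by the maximum of \<open>A p\<close> times the sum of the \<open>A p\<close>.  Up to the number of sparse maps, the
  former is smaller than \<open>n!\<close> by the factor \<open>m!\<close>, and the latter is at most \<open>2 ^ n * n!\<close>.\<close>

lemma card_not_rigid:
  "card {c \<in> perm_pairs n. \<not> rigid n d (3 * m) c} * fact m
     \<le> 8 ^ n * Suc n ^ (2 * d) * card (perm_pairs n)"
proof -
  let ?S = "{p. p permutes {1..n} \<and> 3 * m \<le> card {i \<in> {1..n}. p i \<noteq> i}}"
  let ?C = "almost_centralizer n d" and ?K = "card (sparse_maps n d)"
  let ?B = "{c \<in> perm_pairs n. \<not> rigid n d (3 * m) c}"
  have finS: "finite ?S"
    by (rule finite_subset[of _ "{q. q permutes {1..n}}"]) (auto intro: finite_permutations)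
  have fam: "{c :: bool \<Rightarrow> nat \<Rightarrow> nat. \<forall>s. c s \<in> ?C p} \<subseteq> perm_pairs n" for p
    by (auto simp: perm_pairs_def almost_centralizer_def)
  have "?B \<subseteq> (\<Union>p\<in>?S. {c :: bool \<Rightarrow> nat \<Rightarrow> nat. \<forall>s. c s \<in> ?C p})"
    by (auto simp: rigid_def perm_pairs_def almost_centralizer_def not_less)
  then have "card ?B \<le> card (\<Union>p\<in>?S. {c :: bool \<Rightarrow> nat \<Rightarrow> nat. \<forall>s. c s \<in> ?C p})"
    by (rule card_mono[rotated]) (use finS finite_subset[OF fam finite_perm_pairs] in auto)
  also have "\<dots> \<le> (\<Sum>p\<in>?S. card {c :: bool \<Rightarrow> nat \<Rightarrow> nat. \<forall>s. c s \<in> ?C p})"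
    by (rule card_UN_le[OF finS])
  also have "\<dots> = (\<Sum>p\<in>?S. (card (?C p))\<^sup>2)"
    by (simp only: card_families_bool)
  finally have "card ?B * fact m \<le> (\<Sum>p\<in>?S. (card (?C p))\<^sup>2) * fact m"
    by (rule mult_right_mono) simp
  also have "\<dots> = (\<Sum>p\<in>?S. card (?C p) * (card (?C p) * fact m))"
    by (simp only: sum_distrib_right power2_eq_square mult.assoc)
  also have "\<dots> \<le> (\<Sum>p\<in>?S. card (?C p) * (?K * fact n))"
    by (intro sum_mono mult_left_mono card_almost_centralizer) auto
  also have "\<dots> = (\<Sum>p\<in>?S. card (?C p)) * (?K * fact n)"
    by (simp only: sum_distrib_right)
  also have "\<dots> \<le> (\<Sum>p | p permutes {1..n}. card (?C p)) * (?K * fact n)"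
    by (intro mult_right_mono sum_mono2) (auto intro: finite_permutations)
  also have "\<dots> \<le> (2 ^ n * ?K * fact n) * (?K * fact n)"
    by (rule mult_right_mono[OF sum_card_almost_centralizer]) simp
  also have "\<dots> = 2 ^ n * (?K * ?K) * card (perm_pairs n)"
    by (simp add: card_perm_pairs power2_eq_square)
  also have "\<dots> \<le> 2 ^ n * ((2 ^ n * Suc n ^ d) * (2 ^ n * Suc n ^ d)) * card (perm_pairs n)"
    by (intro mult_right_mono mult_left_mono mult_mono card_sparse_maps) simp_all
  also have "2 ^ n * ((2 ^ n * Suc n ^ d) * (2 ^ n * Suc n ^ d)) = (8::nat) ^ n * Suc n ^ (2 * d)"
  proof -
    have "(8::nat) ^ n = 2 ^ n * 2 ^ n * 2 ^ n"
      by (simp flip: power_mult_distrib)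
    then show ?thesis by (simp add: mult_2 power_add)
  qed
  finally show ?thesis .
qed


section \<open>Generic properties of pairs\<close>

text \<open>Properties that hold for a uniformly random pair with probability tending to \<open>1\<close> as the
  degree grows.\<close>

definition generic_pairs :: "(nat \<Rightarrow> (bool \<Rightarrow> nat \<Rightarrow> nat) \<Rightarrow> bool) \<Rightarrow> bool" where
  "generic_pairs P \<longleftrightarrow>
     (\<lambda>n. real (card {c \<in> perm_pairs n. \<not> P n c}) / real (card (perm_pairs n))) \<longlonglongrightarrow> 0"

lemma card_perm_pairs_pos: "0 < card (perm_pairs n)"
  by (simp add: card_perm_pairs)

lemma generic_pairsI:
  assumes "b \<longlonglongrightarrow> 0"
    and "\<forall>\<^sub>F n in sequentially.
           real (card {c \<in> perm_pairs n. \<not> P n c}) \<le> b n * real (card (perm_pairs n))"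
  shows "generic_pairs P"
  unfolding generic_pairs_def
proof (rule tendsto_sandwich[OF _ _ tendsto_const assms(1)])
  show "\<forall>\<^sub>F n in sequentially. real (card {c \<in> perm_pairs n. \<not> P n c}) / real (card (perm_pairs n)) \<le> b n"
    using assms(2) by eventually_elim (use card_perm_pairs_pos in \<open>simp add: pos_divide_le_eq\<close>)
qed simp

lemma generic_simultaneous:
  assumes I: "finite I" and gen: "\<And>i. i \<in> I \<Longrightarrow> generic_pairs (P i)"
  shows "\<exists>n>0. \<exists>c\<in>perm_pairs n. \<forall>i\<in>I. P i n c"
proof -
  let ?B = "\<lambda>i n. {c \<in> perm_pairs n. \<not> P i n c}" and ?N = "\<lambda>n. card (perm_pairs n)"
  have "(\<lambda>n. \<Sum>i\<in>I. real (card (?B i n)) / real (?N n)) \<longlonglongrightarrow> (\<Sum>i\<in>I. 0)"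
    using gen by (intro tendsto_sum) (simp add: generic_pairs_def)
  then have "\<forall>\<^sub>F n in sequentially. (\<Sum>i\<in>I. real (card (?B i n)) / real (?N n)) < 1"
    by (rule order_tendstoD) simp
  then have "\<forall>\<^sub>F n in sequentially. (\<Sum>i\<in>I. real (card (?B i n)) / real (?N n)) < 1 \<and> 0 < n"
    using eventually_gt_at_top[of "0::nat"] by (rule eventually_conj)
  then obtain n where n: "(\<Sum>i\<in>I. real (card (?B i n)) / real (?N n)) < 1" "0 < n"
    using eventually_happens'[OF sequentially_bot] by blast
  have "\<exists>c\<in>perm_pairs n. \<forall>i\<in>I. P i n c"
  proof (rule ccontr)
    assume "\<not> ?thesis"
    then have "perm_pairs n \<subseteq> (\<Union>i\<in>I. ?B i n)" by blast
    then have "?N n \<le> card (\<Union>i\<in>I. ?B i n)"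
      by (rule card_mono[rotated]) (use I finite_perm_pairs[of n] in auto)
    also have "\<dots> \<le> (\<Sum>i\<in>I. card (?B i n))"
      by (rule card_UN_le[OF I])
    finally have "real (?N n) \<le> (\<Sum>i\<in>I. real (card (?B i n)))"
      by (simp flip: of_nat_sum)
    then have "1 \<le> (\<Sum>i\<in>I. real (card (?B i n)) / real (?N n))"
      using card_perm_pairs_pos[of n] by (simp add: pos_le_divide_eq flip: sum_divide_distrib)
    then show False using n(1) by simp
  qed
  then show ?thesis using n(2) by blast
qed

text \<open>Countably many generic properties can be arranged to hold simultaneously along one sequence: the
  \<open>k\<close>-th pair is chosen to satisfy the finitely many properties with code at most
  \<open>k\<close>.\<close>

lemma generic_diagonal:
  fixes P :: "'i::countable \<Rightarrow> nat \<Rightarrow> (bool \<Rightarrow> nat \<Rightarrow> nat) \<Rightarrow> bool"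
  assumes gen: "\<And>i. generic_pairs (P i)"
  shows "\<exists>n c. (\<forall>k. 0 < n k \<and> c k \<in> perm_pairs (n k)) \<and>
           (\<forall>i. \<forall>\<^sub>F k in sequentially. P i (n k) (c k))"
proof -
  have "\<exists>n c. 0 < n \<and> c \<in> perm_pairs n \<and> (\<forall>i. to_nat i \<le> k \<longrightarrow> P i n c)" for k
  proof -
    have "finite (to_nat -` {..k} :: 'i set)"
      by (rule finite_vimageI) (simp_all add: inj_to_nat)
    from generic_simultaneous[where P = P, OF this gen] obtain m d where "0 < m" "d \<in> perm_pairs m"
      and P: "\<forall>i\<in>to_nat -` {..k}. P i m d" by (elim exE conjE bexE)
    moreover have "\<forall>i. to_nat i \<le> k \<longrightarrow> P i m d"
      using P by (simp add: vimage_def)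
    ultimately show ?thesis by (intro exI conjI)
  qed
  then obtain n c where nc: "\<And>k. 0 < n k \<and> c k \<in> perm_pairs (n k) \<and> (\<forall>i. to_nat i \<le> k \<longrightarrow> P i (n k) (c k))"
    by metis
  have "\<forall>\<^sub>F k in sequentially. P i (n k) (c k)" for i
    using eventually_ge_at_top[of "to_nat i"] by eventually_elim (use nc in blast)
  then show ?thesis using nc by blast
qed

lemma generic_few_fixed_points:
  assumes "reduced w" "w \<noteq> []"
  shows "generic_pairs (\<lambda>n c. r * card {x \<in> {1..n}. word_act c w x = x} < n)"
proof (rule generic_pairsI)
  let ?a = "real (r * (length w)\<^sup>2)"
  show "(\<lambda>n. ?a / real (n - length w)) \<longlonglongrightarrow> 0"
  proof (rule real_tendsto_divide_at_top[OF tendsto_const])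
    show "filterlim (\<lambda>n. real (n - length w)) at_top sequentially"
      by (rule filterlim_compose[OF filterlim_real_sequentially filterlim_minus_const_nat_at_top])
  qed
  show "\<forall>\<^sub>F n in sequentially.
      real (card {c \<in> perm_pairs n. \<not> r * card {x \<in> {1..n}. word_act c w x = x} < n})
        \<le> ?a / real (n - length w) * real (card (perm_pairs n))"
    using eventually_gt_at_top[of "length w"]
  proof eventually_elim
    case (elim n)
    have "real (card {c \<in> perm_pairs n. n \<le> r * card {x \<in> {1..n}. word_act c w x = x}} * (n - length w))
        \<le> real (r * (length w)\<^sup>2 * card (perm_pairs n))"
      by (rule of_nat_mono[OF card_fixed_points_large[OF assms]])
    then show ?case
      using elim by (simp add: not_less pos_le_divide_eq)
  qed
qed

lemma power_le_fact_add: "m ^ j \<le> (fact (m + j) :: nat)"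
proof (induction j)
  case (Suc j)
  have "m * m ^ j \<le> Suc (m + j) * fact (m + j)"
    by (rule mult_mono) (use Suc in simp_all)
  then show ?case by simp
qed simp

text \<open>With \<open>t = n div (24 * r)\<close>, almost commuting means up to about \<open>n / (24 * r)\<close> points, and
  the conclusion bounds the moved points by \<open>24 * t \<le> n / r\<close>.  The count of pairs that are not rigid applies with
  \<open>m = 8 * t\<close>: there, \<open>m! \<ge> (4 * t) ^ (4 * t)\<close> outgrows the errors
  \<open>Suc n ^ (2 * t)\<close>, of order \<open>t ^ (2 * t)\<close> up to exponential factors, and the ratio is at most
  \<open>(K / t\<^sup>2) ^ t\<close>.\<close>

lemma generic_rigid:
  assumes r: "0 < r"
  shows "generic_pairs (\<lambda>n. rigid n (n div (24 * r)) (24 * (n div (24 * r))))"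
proof (rule generic_pairsI)
  define K :: nat where "K = 8 ^ (48 * r) * (48 * r)\<^sup>2"
  let ?t = "\<lambda>n. n div (24 * r)"
  have t_top: "filterlim ?t at_top sequentially"
  proof (unfold filterlim_at_top, intro allI)
    fix Z :: nat
    show "\<forall>\<^sub>F n in sequentially. Z \<le> ?t n"
      using eventually_ge_at_top[of "Z * (24 * r)"]
      by eventually_elim (use r in \<open>simp add: less_eq_div_iff_mult_less_eq\<close>)
  qed
  show "(\<lambda>n. real K / (real (?t n))\<^sup>2) \<longlonglongrightarrow> 0"
    by (intro real_tendsto_divide_at_top[OF tendsto_const] filterlim_pow_at_top
          filterlim_compose[OF filterlim_real_sequentially t_top]) simp
  show "\<forall>\<^sub>F n in sequentially.
      real (card {c \<in> perm_pairs n. \<not> rigid n (?t n) (24 * ?t n) c})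
        \<le> real K / (real (?t n))\<^sup>2 * real (card (perm_pairs n))"
    using t_top[unfolded filterlim_at_top, rule_format, of "K + 1"]
  proof eventually_elim
    case (elim n)
    let ?B = "card {c \<in> perm_pairs n. \<not> rigid n (?t n) (24 * ?t n) c}" and ?N = "card (perm_pairs n)"
    define t where "t = ?t n"
    have t: "K + 1 \<le> t" using elim by (simp add: t_def)
    have "n mod (24 * r) < 24 * r" using r by simp
    then have "n + 1 \<le> 24 * r * t + 24 * r"
      using mult_div_mod_eq[of "24 * r" n] unfolding t_def by linarith
    also have "\<dots> \<le> 48 * r * t"
      using t by (simp add: algebra_simps)
    finally have n: "Suc n \<le> 48 * r * t" by simp
    have "(8::nat) ^ n * Suc n ^ (2 * t) \<le> 8 ^ (48 * r * t) * (48 * r * t) ^ (2 * t)"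
      using n by (intro mult_mono power_increasing power_mono) simp_all
    also have "\<dots> = (K * t\<^sup>2) ^ t"
      by (simp add: K_def power_mult power_mult_distrib)
    finally have num: "(8::nat) ^ n * Suc n ^ (2 * t) \<le> (K * t\<^sup>2) ^ t" .
    have "(t ^ 4) ^ t = t ^ (4 * t)" by (simp add: power_mult)
    also have "\<dots> \<le> (4 * t) ^ (4 * t)" by (rule power_mono) simp_all
    also have "\<dots> \<le> fact (4 * t + 4 * t)" by (rule power_le_fact_add)
    finally have den: "(t ^ 4) ^ t \<le> (fact (8 * t) :: nat)" by simp
    have "?B * (t ^ 4) ^ t \<le> ?B * fact (8 * t)"
      by (rule mult_left_mono[OF den]) simp
    also have "\<dots> \<le> 8 ^ n * Suc n ^ (2 * t) * ?N"
      using card_not_rigid[of n t "8 * t"] by (simp add: t_def)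
    also have "\<dots> \<le> (K * t\<^sup>2) ^ t * ?N"
      by (rule mult_right_mono[OF num]) simp
    finally have "real (?B * (t ^ 4) ^ t) \<le> real ((K * t\<^sup>2) ^ t * ?N)"
      by (rule of_nat_mono)
    then have le: "real ?B * (real t ^ 4) ^ t \<le> (real K * (real t)\<^sup>2) ^ t * real ?N"
      by simp
    have tpos: "0 < real t" using t by simp
    have "real ?B \<le> (real K * (real t)\<^sup>2) ^ t * real ?N / (real t ^ 4) ^ t"
      using le tpos by (simp add: pos_le_divide_eq)
    also have "\<dots> = (real K * (real t)\<^sup>2 / real t ^ 4) ^ t * real ?N"
      by (simp only: power_divide times_divide_eq_left)
    also have "\<dots> = (real K / (real t)\<^sup>2) ^ t * real ?N"
    proof -
      have "real K * (real t)\<^sup>2 / real t ^ 4 = real K / (real t)\<^sup>2"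
        using tpos by (simp add: power2_eq_square power4_eq_xxxx)
      then show ?thesis by (simp only:)
    qed
    also have "\<dots> \<le> (real K / (real t)\<^sup>2) ^ 1 * real ?N"
    proof (intro mult_right_mono power_decreasing)
      have "real K \<le> real t" "1 \<le> real t" using t by simp_all
      then have "real K \<le> (real t)\<^sup>2"
        using mult_mono[of "real K" "real t" 1 "real t"] by (simp add: power2_eq_square)
      then show "real K / (real t)\<^sup>2 \<le> 1" using tpos by simp
    qed (use t in simp_all)
    finally show ?case by (simp add: t_def)
  qed
qed

section \<open>The sofic representation and its commutant\<close>

lemma nonprincipal_ultrafilter_le_sequentially:
  assumes "nonprincipal_ultrafilter \<omega>"
  shows "\<omega> \<le> sequentially"
proof (rule filter_leI)
  fix P :: "nat \<Rightarrow> bool" assume "eventually P sequentially"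
  then obtain N where N: "\<And>k. N \<le> k \<Longrightarrow> P k"
    by (auto simp: eventually_sequentially)
  have "\<forall>\<^sub>F k in \<omega>. k \<noteq> a" for a
    using assms unfolding nonprincipal_ultrafilter_iff is_ultrafilter_def by blast
  then have "\<forall>\<^sub>F k in \<omega>. \<forall>a\<in>{..<N}. k \<noteq> a"
    by (intro eventually_ball_finite) auto
  then show "eventually P \<omega>"
    by (rule eventually_mono) (metis N lessThan_iff not_le)
qed

definition word_class ::
    "nat filter \<Rightarrow> (nat \<Rightarrow> nat) \<Rightarrow> (nat \<Rightarrow> bool \<Rightarrow> nat \<Rightarrow> nat) \<Rightarrow> (bool \<times> bool) list \<Rightarrow>
      (nat \<Rightarrow> nat \<Rightarrow> nat) set" where
  "word_class \<omega> n c w = sofic_kernel \<omega> n #>\<^bsub>sym_product n\<^esub> (\<lambda>k. word_act (c k) w)"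

lemma word_act_in_sym_product:
  assumes "\<And>k. c k \<in> perm_pairs (n k)"
  shows "(\<lambda>k. word_act (c k) w) \<in> carrier (sym_product n)"
  unfolding sym_product_carrier by (intro allI word_act_permutes assms)

lemma word_class_hom:
  assumes c: "\<And>k. c k \<in> perm_pairs (n k)"
  shows "word_class \<omega> n c \<in> hom free_group_2 (universal_sofic_group \<omega> n)"
proof -
  have "(\<lambda>w k. word_act (c k) w) \<in> hom free_group_2 (sym_product n)"
  proof (rule homI)
    fix u v
    have "(\<lambda>k. word_act (c k) (foldr cancel_Cons u v)) =
        (\<lambda>k. word_act (c k) u) \<otimes>\<^bsub>sym_product n\<^esub> (\<lambda>k. word_act (c k) v)"
      by (rule ext) (simp only: sym_product_mult word_act_mult[OF c])
    then show "(\<lambda>k. word_act (c k) (u \<otimes>\<^bsub>free_group_2\<^esub> v)) =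
        (\<lambda>k. word_act (c k) u) \<otimes>\<^bsub>sym_product n\<^esub> (\<lambda>k. word_act (c k) v)"
      by (simp only: free_group_def monoid.simps)
  qed (rule word_act_in_sym_product[OF c])
  from hom_compose[OF this normal.r_coset_hom_Mod[OF sofic_kernel_normal]]
  show ?thesis
    by (simp only: universal_sofic_group_def word_class_def[abs_def] comp_def)
qed

lemma universal_sofic_group_one:
  "\<one>\<^bsub>universal_sofic_group \<omega> n\<^esub> = sofic_kernel \<omega> n #>\<^bsub>sym_product n\<^esub> \<one>\<^bsub>sym_product n\<^esub>"
  using group.coset_mult_one[OF group_sym_product
      subgroup.subset[OF normal_imp_subgroup[OF sofic_kernel_normal]]]
  by (simp only: universal_sofic_group_def one_FactGroup)

lemma word_class_sofic:
  assumes \<omega>: "is_ultrafilter \<omega>" and c: "\<And>k. c k \<in> perm_pairs (n k)" and n: "\<And>k. 0 < n k"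
    and few: "\<And>w r. reduced w \<Longrightarrow> w \<noteq> [] \<Longrightarrow>
      \<forall>\<^sub>F k in \<omega>. Suc r * card {x \<in> {1..n k}. word_act (c k) w x = x} < n k"
  shows "sofic_representation \<omega> n free_group_2 (word_class \<omega> n c)"
  unfolding sofic_representation_def
proof (intro conjI ballI impI word_class_hom[OF c])
  fix w assume w: "w \<in> carrier free_group_2" "w \<noteq> \<one>\<^bsub>free_group_2\<^esub>"
  then have red: "reduced w" "w \<noteq> []" by (auto simp: free_group_def)
  let ?d = "\<lambda>k. hamming_dist (n k) (word_act (c k) w) id"
  have nb: "\<omega> \<noteq> bot" using \<omega> by (simp add: is_ultrafilter_def)
  have "?d k = 1 - real (card {x \<in> {1..n k}. word_act (c k) w x = x}) / real (n k)" for k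
  proof -
    let ?F = "{x \<in> {1..n k}. word_act (c k) w x = x}"
    have "{x \<in> {1..n k}. word_act (c k) w x \<noteq> id x} = {1..n k} - ?F" by auto
    moreover have "card ({1..n k} - ?F) = n k - card ?F"
      by (subst card_Diff_subset) auto
    moreover have "card ?F \<le> card {1..n k}" by (rule card_mono) auto
    ultimately show ?thesis
      using n[of k] by (simp add: hamming_dist_def of_nat_diff diff_divide_distrib)
  qed
  note dist = this
  have "(?d \<longlongrightarrow> 1) \<omega>"
  proof (rule order_tendstoI)
    fix a :: real assume "a < 1"
    then obtain r where r: "inverse (real (Suc r)) < 1 - a"
      using reals_Archimedean[of "1 - a"] by auto
    show "\<forall>\<^sub>F k in \<omega>. a < ?d k"
      using few[OF red, of r]
    proof eventually_elim
      case (elim k)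
      then have "real (Suc r) * real (card {x \<in> {1..n k}. word_act (c k) w x = x}) < real (n k)"
        unfolding of_nat_mult[symmetric] of_nat_less_iff .
      then have "real (card {x \<in> {1..n k}. word_act (c k) w x = x}) / real (n k) < inverse (real (Suc r))"
        using n[of k] by (simp add: field_simps)
      then show ?case using r unfolding dist by linarith
    qed
  next
    fix a :: real assume "1 < a"
    then show "\<forall>\<^sub>F k in \<omega>. ?d k < a"
      by (intro always_eventually allI) (rule le_less_trans[OF hamming_dist_le_1])
  qed
  moreover have "(?d \<longlongrightarrow> sofic_dist \<omega> n (word_class \<omega> n c w) \<one>\<^bsub>universal_sofic_group \<omega> n\<^esub>) \<omega>"
    using sofic_dist_tendsto[OF \<omega> word_act_in_sym_product[OF c] group.is_monoid[OF group_sym_product, THEN monoid.one_closed]]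
    by (simp only: sym_product_one universal_sofic_group_one word_class_def)
  ultimately show "sofic_dist \<omega> n (word_class \<omega> n c w) \<one>\<^bsub>universal_sofic_group \<omega> n\<^esub> = 1"
    using tendsto_unique[OF nb] by blast
qed

text \<open>An element of the commutant lifts to a sequence \<open>p\<close> with \<open>p k\<close> almost commuting with the two
  permutations in \<open>c k\<close>; rigidity at the scale \<open>r\<close> bounds the distance of \<open>p k\<close> from the identity by
  \<open>1 / r\<close>, for every \<open>r\<close>.\<close>

lemma word_class_commutant:
  assumes c: "\<And>k. c k \<in> perm_pairs (n k)" and n: "\<And>k. 0 < n k"
    and rigid: "\<And>r. 0 < r \<Longrightarrow>
      \<forall>\<^sub>F k in \<omega>. rigid (n k) (n k div (24 * r)) (24 * (n k div (24 * r))) (c k)"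
  shows "commutant (universal_sofic_group \<omega> n) (word_class \<omega> n c ` carrier free_group_2)
           = {\<one>\<^bsub>universal_sofic_group \<omega> n\<^esub>}"
proof -
  let ?U = "universal_sofic_group \<omega> n" and ?N = "sofic_kernel \<omega> n" and ?G = "sym_product n"
  interpret U: group ?U by (rule group_universal_sofic_group)
  interpret G: group ?G by (rule group_sym_product)
  interpret N: normal ?N ?G by (rule sofic_kernel_normal)
  have "X = \<one>\<^bsub>?U\<^esub>"
    if X: "X \<in> carrier ?U"
      and com: "\<And>w. w \<in> carrier free_group_2 \<Longrightarrow>
        X \<otimes>\<^bsub>?U\<^esub> word_class \<omega> n c w = word_class \<omega> n c w \<otimes>\<^bsub>?U\<^esub> X" for X
  proof -
    obtain p where p: "p \<in> carrier ?G" and X_eq: "X = ?N #>\<^bsub>?G\<^esub> p"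
      using X unfolding universal_sofic_group_def carrier_FactGroup by blast
    have perm: "p k permutes {1..n k}" for k
      using p by (simp only: sym_product_carrier)
    have lim: "((\<lambda>k. hamming_dist (n k) (c k s \<circ> p k) (p k \<circ> c k s)) \<longlongrightarrow> 0) \<omega>" for s
    proof -
      let ?w = "[(s, True)]"
      let ?g = "\<lambda>k. word_act (c k) ?w"
      have g: "?g \<in> carrier ?G" by (rule word_act_in_sym_product[OF c])
      have g_eq: "?g k = c k s" for k by (simp add: letter_act_def)
      have "?w \<in> carrier free_group_2" by (simp add: free_group_def reduced_def)
      from com[OF this] have "?N #>\<^bsub>?G\<^esub> (p \<otimes>\<^bsub>?G\<^esub> ?g) = ?N #>\<^bsub>?G\<^esub> (?g \<otimes>\<^bsub>?G\<^esub> p)"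
        by (simp only: universal_sofic_group_def mult_FactGroup X_eq word_class_def N.rcos_sum p g)
      moreover have "?g \<otimes>\<^bsub>?G\<^esub> p \<in> ?N #>\<^bsub>?G\<^esub> (?g \<otimes>\<^bsub>?G\<^esub> p)"
        by (rule G.rcos_self[OF G.m_closed[OF g p] N.subgroup_axioms])
      ultimately have "?g \<otimes>\<^bsub>?G\<^esub> p \<in> ?N #>\<^bsub>?G\<^esub> (p \<otimes>\<^bsub>?G\<^esub> ?g)"
        by (simp only:)
      from sofic_coset_dist[OF G.m_closed[OF p g] this] show ?thesis
        by (simp only: sym_product_mult g_eq)
    qed
    have "((\<lambda>k. hamming_dist (n k) (p k) id) \<longlongrightarrow> 0) \<omega>"
    proof (rule order_tendstoI)
      fix a :: real assume "0 < a"
      then obtain j where j: "inverse (real (Suc j)) < a"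
        using reals_Archimedean by blast
      define r where "r = Suc j"
      have r: "0 < r" "1 / real r < a"
        using j by (simp_all add: r_def field_simps)
      have "\<forall>\<^sub>F k in \<omega>. hamming_dist (n k) (c k s \<circ> p k) (p k \<circ> c k s) < 1 / real (24 * r)" for s
        using lim[of s] by (rule order_tendstoD) (use r in simp)
      then have "\<forall>\<^sub>F k in \<omega>. \<forall>s. hamming_dist (n k) (c k s \<circ> p k) (p k \<circ> c k s) < 1 / real (24 * r)"
        by (simp add: eventually_all_finite)
      then show "\<forall>\<^sub>F k in \<omega>. hamming_dist (n k) (p k) id < a"
        using rigid[OF r(1)]
      proof eventually_elim
        case (elim k)
        let ?t = "n k div (24 * r)"
        have "card {i \<in> {1..n k}. c k s (p k i) \<noteq> p k (c k s i)} \<le> ?t" for s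
        proof -
          let ?m = "card {i \<in> {1..n k}. c k s (p k i) \<noteq> p k (c k s i)}"
          have "real ?m / real (n k) < 1 / real (24 * r)"
            using elim(1) by (simp add: hamming_dist_def)
          then have "real (?m * (24 * r)) < real (n k)"
            using n[of k] r(1) by (simp add: field_simps)
          then have "?m * (24 * r) \<le> n k"
            unfolding of_nat_less_iff by simp
          then show ?thesis using r(1) by (simp add: less_eq_div_iff_mult_less_eq)
        qed
        then have "card {i \<in> {1..n k}. p k i \<noteq> i} < 24 * ?t"
          using elim(2) perm unfolding rigid_def by blast
        then have "r * card {i \<in> {1..n k}. p k i \<noteq> i} \<le> r * (24 * ?t)"
          by (intro mult_left_mono) simp_all
        also have "\<dots> \<le> n k"
          using div_times_less_eq_dividend[of "n k" "24 * r"] by (simp add: algebra_simps)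
        finally have "real (r * card {i \<in> {1..n k}. p k i \<noteq> i}) \<le> real (n k)"
          by (rule of_nat_mono)
        then have "hamming_dist (n k) (p k) id \<le> 1 / real r"
          using n[of k] r(1) by (simp add: hamming_dist_def field_simps)
        then show ?case using r(2) by simp
      qed
    next
      fix a :: real assume "a < 0"
      then show "\<forall>\<^sub>F k in \<omega>. a < hamming_dist (n k) (p k) id"
        by (intro always_eventually allI) (rule less_le_trans[OF _ hamming_dist_nonneg])
    qed
    then have "p \<in> ?N" using p by (simp only: sofic_kernel_iff)
    then show "X = \<one>\<^bsub>?U\<^esub>"
      using G.coset_join2[OF p N.subgroup_axioms]
      by (simp only: X_eq universal_sofic_group_def one_FactGroup)
  qed
  moreover have "word_class \<omega> n c w \<in> carrier ?U" if "w \<in> carrier free_group_2" for w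
    using word_class_hom[OF c] that by (rule hom_in_carrier)
  ultimately show ?thesis
    unfolding commutant_def by auto
qed

theorem theorem3p2:
  fixes \<omega> :: "nat filter"
  assumes "nonprincipal_ultrafilter \<omega>"
  shows "\<exists>n :: nat \<Rightarrow> nat. (\<forall>k. n k > 0) \<and>
    (\<exists>\<theta>. sofic_representation \<omega> n free_group_2 \<theta> \<and>
         commutant (universal_sofic_group \<omega> n) (\<theta> ` carrier free_group_2)
           = {\<one>\<^bsub>universal_sofic_group \<omega> n\<^esub>})"
proof -
  \<comment> \<open>the scale \<open>r\<close> enters as \<open>Suc r\<close> so that every natural number is an admissible index\<close>
  define few where "few w r n c \<longleftrightarrow>
      (reduced w \<and> w \<noteq> [] \<longrightarrow> Suc r * card {x \<in> {1..n}. word_act c w x = x} < n)"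
    for w :: "(bool \<times> bool) list" and r n :: nat and c :: "bool \<Rightarrow> nat \<Rightarrow> nat"
  define stiff where "stiff r n c \<longleftrightarrow> rigid n (n div (24 * Suc r)) (24 * (n div (24 * Suc r))) c"
    for r n c
  define P where "P = case_sum (\<lambda>(w, r). few w r) stiff"
  have "generic_pairs (few w r)" for w r
  proof (cases "reduced w \<and> w \<noteq> []")
    case True
    then show ?thesis
      using generic_few_fixed_points[of w "Suc r"] by (simp add: few_def[abs_def])
  next
    case False
    then have "few w r = (\<lambda>n c. True)" by (auto simp: few_def fun_eq_iff)
    then show ?thesis by (simp add: generic_pairs_def)
  qed
  moreover have "generic_pairs (stiff r)" for r
    using generic_rigid[of "Suc r"] by (simp add: stiff_def[abs_def])
  ultimately have "generic_pairs (P i)" for i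
    by (cases i) (auto simp: P_def)
  from generic_diagonal[of P, OF this]
  obtain n c where nc: "\<And>k. 0 < n k" "\<And>k. c k \<in> perm_pairs (n k)"
    and ev: "\<And>i. \<forall>\<^sub>F k in sequentially. P i (n k) (c k)"
    by blast
  have ev: "\<forall>\<^sub>F k in \<omega>. P i (n k) (c k)" for i
    using nonprincipal_ultrafilter_le_sequentially[OF assms] ev by (rule filter_leD)
  have "\<forall>\<^sub>F k in \<omega>. Suc r * card {x \<in> {1..n k}. word_act (c k) w x = x} < n k"
    if "reduced w" "w \<noteq> []" for w r
    using ev[of "Inl (w, r)"] that by (simp add: P_def few_def)
  moreover have "\<forall>\<^sub>F k in \<omega>. rigid (n k) (n k div (24 * r)) (24 * (n k div (24 * r))) (c k)"
    if "0 < r" for r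
    using ev[of "Inr (r - 1)"] that by (simp add: P_def stiff_def)
  moreover have "is_ultrafilter \<omega>"
    using assms by (simp add: nonprincipal_ultrafilter_def)
  ultimately have "sofic_representation \<omega> n free_group_2 (word_class \<omega> n c)"
    "commutant (universal_sofic_group \<omega> n) (word_class \<omega> n c ` carrier free_group_2)
       = {\<one>\<^bsub>universal_sofic_group \<omega> n\<^esub>}"
    using nc by (simp_all add: word_class_sofic word_class_commutant)
  then show ?thesis using nc(1) by blast
qed

end
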